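(* Let $A\in\mathbb{C}^{n\times n}$, let $1\le \ell<m$, and let $\Omega\in\mathbb{C}^{d\times n}$ be a sketching matrix. Consider a Krylov decomposition $$A U_m^{(\mathrm{old})}=U_m^{(\mathrm{old})}\widehat H_m^{(\mathrm{old})}+\widehat u_{m+1}^{(\mathrm{old})}(c_m^{(\mathrm{old})})^{\mathsf H},\qquad (U_m^{(\mathrm{old})})^{\mathsf H}\widehat u_{m+1}^{(\mathrm{old})}=0,\tag{K}$$ with $U_m^{(\mathrm{old})}\in\mathbb{C}^{n\times m}$ of full column rank, and an ordered Schur decomposition $$\widehat H_m^{(\mathrm{old})}\begin{bmatrix}\widehat V_\ell^{(\mathrm{old})}&\widehat V_\perp^{(\mathrm{old})}\end{bmatrix}=\begin{bmatrix}\widehat V_\ell^{(\mathrm{old})}&\widehat V_\perp^{(\mathrm{old})}\end{bmatrix}\begin{bmatrix}\widehat S_\ell^{(\mathrm{old})}&\widehat S_{\ell\perp}^{(\mathrm{old})}\\0&\widehat S_\perp^{(\mathrm{old})}\end{bmatrix},$$ where $\widehat S_\ell^{(\mathrm{old})}$ is $\ell\times\ell$, and assume that the eigenvalues of the diagonal blocks $\widehat S_\ell^{(\mathrm{old})}$ and $\widehat S_\perp^{(\mathrm{old})}$ are disjoint. Let $$A U_m^{(\mathrm{new})}=U_m^{(\mathrm{new})}\widehat H_m^{(\mathrm{new})}+\widehat u_{m+1}^{(\mathrm{new})}(c_m^{(\mathrm{new})})^{\mathsf H},\qquad (U_m^{(\mathrm{new})})^{\mathsf H}\widehat u_{m+1}^{(\mathrm{new})}=0,\tag{K'}$$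 be the Krylov decomposition obtained from (K) by one cycle of the similarity-restoring randomized Krylov--Schur method (as described in the context) using this Schur decomposition, and let $$A\widehat Q_m^{(\mathrm{new})}=\widehat Q_m^{(\mathrm{new})}\widehat G_m^{(\mathrm{new})}+\widehat u_{m+1}^{(\mathrm{new})}(\widehat c_m^{(\mathrm{new})})^{\mathsf H}$$ be the orthonormal Krylov decomposition associated with (K'). Now consider the orthonormal Krylov decomposition associated with (K), $$A\widehat Q_m^{(\mathrm{old})}=\widehat Q_m^{(\mathrm{old})}\widehat G_m^{(\mathrm{old})}+\widehat u_{m+1}^{(\mathrm{old})}(\widehat c_m^{(\mathrm{old})})^{\mathsf H},$$ and a partial Schur decomposition $\widehat G_m^{(\mathrm{old})}\widetilde V_\ell^{(\mathrm{old})}=\widetilde V_\ell^{(\mathrm{old})}\widetilde S_\ell^{(\mathrm{old})}$ such that the eigenvalues of $\widehat S_\ell^{(\mathrm{old})}$ and $\widetilde S_\ell^{(\mathrm{old})}$ are the same. Suppose that the corresponding compressed Krylov decomposition $$A\widehat Q_m^{(\mathrm{old})}\widetilde V_\ell^{(\mathrm{old})}=\widehat Q_m^{(\mathrm{old})}\widetilde V_\ell^{(\mathrm{old})}\widetilde S_\ell^{(\mathrm{old})}+\widehat u_{m+1}^{(\mathrm{old})}(\widehat c_m^{(\mathrm{old})})^{\mathsf H}\widetilde V_\ell^{(\mathrm{old})}$$ is expanded by performing $m-\ell\ge 1$ steps of the standard Arnoldi process, leading to the order-$m$ Krylov decomposition $$A\widetilde Q_m=\widetilde Q_m\widetilde G_m+\widetilde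 g_{m+1,m}\widetilde q_{m+1}\widetilde c_m^{\mathsf H}.$$ Then this Krylov decomposition is equivalent to the orthonormal Krylov decomposition associated with (K'), that is, $$\mathsf{range}(\widetilde Q_m)=\mathsf{range}(\widehat Q_m^{(\mathrm{new})})\quad\text{and}\quad \mathsf{span}\{\widetilde q_{m+1}\}=\mathsf{span}\{\widehat u_{m+1}^{(\mathrm{new})}\}.$$
   Context: All computations are in exact arithmetic. $(\cdot)^{\mathsf H}$ is the conjugate transpose, $(\cdot)^{-\mathsf H}$ the inverse of the conjugate transpose, $(\cdot)^\dagger$ the Moore--Penrose pseudoinverse, $\|\cdot\|$ the Euclidean norm, and $e_m$ the $m$th unit vector in $\mathbb{C}^m$. "The eigenvalues are the same" is understood counting multiplicities. In an (ordered) Schur decomposition the matrix $[\widehat V_\ell,\widehat V_\perp]$ is unitary and the block matrix on the right is upper triangular; in a partial Schur decomposition $GV_\ell=V_\ell S_\ell$ the matrix $V_\ell\in\mathbb{C}^{m\times\ell}$ has orthonormal columns and $S_\ell\in\mathbb{C}^{\ell\times\ell}$ is upper triangular. Associated orthonormal Krylov decomposition: given $AU_m=U_m\widehat H_m+\widehat u_{m+1}c_m^{\mathsf H}$ with $U_m$ of full column rank and $U_m^{\mathsf H}\widehat u_{m+1}=0$, let the columns of $\widehat Q_m$ be an orthonormal basis of $\mathsf{range}(U_m)$; the associated orthonormal Krylov decomposition is $A\widehat Q_m=\widehat Q_m\widehat G_m+\widehat u_{m+1}\widehat c_m^{\mathsf H}$ with $\widehat G_m=\widehat Q_m^{\mathsf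 H}A\widehat Q_m$, $\widehat c_m=(\widehat Q_m^{\mathsf H}U_m)^{-\mathsf H}c_m$ and $\widehat Q_m^{\mathsf H}\widehat u_{m+1}=0$. One cycle of the similarity-restoring randomized Krylov--Schur method, starting from (K): (1) Compression: set $U_\ell^{(\mathrm{new})}=U_m^{(\mathrm{old})}\widehat V_\ell^{(\mathrm{old})}$, $\widehat H_\ell^{(\mathrm{new})}=\widehat S_\ell^{(\mathrm{old})}$, $\widehat u_{\ell+1}^{(\mathrm{new})}=\widehat u_{m+1}^{(\mathrm{old})}$, $c_\ell^{(\mathrm{new})}=(\widehat V_\ell^{(\mathrm{old})})^{\mathsf H}c_m^{(\mathrm{old})}$, so that $AU_\ell^{(\mathrm{new})}=U_\ell^{(\mathrm{new})}\widehat H_\ell^{(\mathrm{new})}+\widehat u_{\ell+1}^{(\mathrm{new})}(c_\ell^{(\mathrm{new})})^{\mathsf H}$. (2) Expansion by $m-\ell$ steps of the randomized Arnoldi process: put $u_{\ell+1}=\widehat u_{\ell+1}^{(\mathrm{new})}$ and $U_{\ell+1}=[U_\ell^{(\mathrm{new})},u_{\ell+1}]$; for $k=\ell+1,\dots,m$ compute $w=Au_k$, $h_k=(\Omega U_k)^\dagger(\Omega w)$, $\widetilde u_{k+1}=w-U_kh_k$, $h_{k+1,k}=\|\Omega\widetilde u_{k+1}\|$, $u_{k+1}=\widetilde u_{k+1}/h_{k+1,k}$, $U_{k+1}=[U_k,u_{k+1}]$. Set $U_m^{(\mathrm{new})}=U_m$ and $u_{m+1}^{(\mathrm{new})}=u_{m+1}$.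 This yields $AU_m^{(\mathrm{new})}=U_m^{(\mathrm{new})}H_m^{(\mathrm{new})}+u_{m+1}^{(\mathrm{new})}(c_m^{(\mathrm{new})})^{\mathsf H}$ with $c_m^{(\mathrm{new})}=h_{m+1,m}e_m$, where $H_m^{(\mathrm{new})}$ collects $\widehat H_\ell^{(\mathrm{new})}$, $c_\ell^{(\mathrm{new})}$ and the coefficients computed in the expansion. (3) Correction: with $\widehat h_m=(U_m^{(\mathrm{new})})^\dagger u_{m+1}^{(\mathrm{new})}$, set $\widehat u_{m+1}^{(\mathrm{new})}=u_{m+1}^{(\mathrm{new})}-U_m^{(\mathrm{new})}\widehat h_m$ and $\widehat H_m^{(\mathrm{new})}=H_m^{(\mathrm{new})}+\widehat h_m(c_m^{(\mathrm{new})})^{\mathsf H}$, which gives (K'). Expansion by standard Arnoldi of the compressed orthonormal decomposition: start from the orthonormal columns $\widehat Q_m^{(\mathrm{old})}\widetilde V_\ell^{(\mathrm{old})}$, append $\widetilde q_{\ell+1}=\widehat u_{m+1}^{(\mathrm{old})}/\|\widehat u_{m+1}^{(\mathrm{old})}\|$, and for $k=\ell+1,\dots,m$ orthogonalize $A\widetilde q_k$ against all previous basis vectors by Gram--Schmidt (in the Euclidean inner product) and normalize to obtain $\widetilde q_{k+1}$; $\widetilde Q_m$ consists of the first $m$ basis vectors, and $\widetilde q_{m+1}$ is the last one. Standing assumptions: no breakdown occurs (the vector $\widehat u_{m+1}^{(\mathrm{old})}$ and all vectors to be normalized in the two Arnoldi processes are nonzero), and $\Omega$ is an $\varepsilon$-subspace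 embedding, for some $\varepsilon\in(0,1)$, of the subspace $\mathcal W$ spanned by all basis vectors involved, including $u_{m+1}^{(\mathrm{new})}$, i.e. $(1-\varepsilon)\|w\|^2\le\|\Omega w\|^2\le(1+\varepsilon)\|w\|^2$ for all $w\in\mathcal W$. *)

theory Defs
  imports
    "Jordan_Normal_Form.Spectral_Radius"
    "Jordan_Normal_Form.DL_Rank"
    "HOL-Computational_Algebra.Fundamental_Theorem_Algebra"
begin

abbreviation cspan :: "nat \<Rightarrow> complex vec set \<Rightarrow> complex vec set" where
  "cspan n S \<equiv> module.span class_ring (module_vec TYPE(complex) n) S"

abbreviation range_mat :: "complex mat \<Rightarrow> complex vec set" where
  "range_mat M \<equiv> vec_space.col_space (dim_row M) M"

definition cvec_norm :: "complex vec \<Rightarrow> real" where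
  "cvec_norm v = sqrt (\<Sum>i<dim_vec v. (cmod (v $ i))\<^sup>2)"

definition outer_prod :: "complex vec \<Rightarrow> complex vec \<Rightarrow> complex mat" where
  "outer_prod u c = mat_of_cols (dim_vec u) [u] * mat_adjoint (mat_of_cols (dim_vec c) [c])"

definition hcat :: "complex mat \<Rightarrow> complex mat \<Rightarrow> complex mat" where
  "hcat M N = mat_of_cols (dim_row M) (cols M @ cols N)"

definition orthonormal_cols :: "complex mat \<Rightarrow> bool" where
  "orthonormal_cols Q \<longleftrightarrow> mat_adjoint Q * Q = 1\<^sub>m (dim_col Q)"

definition unitary_mat :: "complex mat \<Rightarrow> bool" where
  "unitary_mat V \<longleftrightarrow> square_mat V \<and> orthonormal_cols V"

definition full_col_rank :: "complex mat \<Rightarrow> bool" where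
  "full_col_rank U \<longleftrightarrow> vec_space.rank (dim_row U) U = dim_col U"

definition pinv :: "complex mat \<Rightarrow> complex mat" where
  "pinv M = (THE X. X \<in> carrier_mat (dim_col M) (dim_row M) \<and>
     M * X * M = M \<and> X * M * X = X \<and>
     mat_adjoint (M * X) = M * X \<and> mat_adjoint (X * M) = X * M)"

definition eigvals :: "complex mat \<Rightarrow> complex multiset" where
  "eigvals M = proots (char_poly M)"

definition subspace_embedding :: "real \<Rightarrow> complex mat \<Rightarrow> complex vec set \<Rightarrow> bool" where
  "subspace_embedding \<epsilon> \<Omega> W \<longleftrightarrow> (\<forall>w\<in>W.
     (1 - \<epsilon>) * (cvec_norm w)\<^sup>2 \<le> (cvec_norm (\<Omega> *\<^sub>v w))\<^sup>2 \<and>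
     (cvec_norm (\<Omega> *\<^sub>v w))\<^sup>2 \<le> (1 + \<epsilon>) * (cvec_norm w)\<^sup>2)"

definition ordered_schur ::
  "complex mat \<Rightarrow> nat \<Rightarrow> nat \<Rightarrow> complex mat \<Rightarrow> complex mat \<Rightarrow> complex mat \<Rightarrow> complex mat \<Rightarrow> complex mat \<Rightarrow> bool"
where
  "ordered_schur H m l V V' S Sx S' \<longleftrightarrow>
     V \<in> carrier_mat m l \<and> V' \<in> carrier_mat m (m - l) \<and>
     S \<in> carrier_mat l l \<and> Sx \<in> carrier_mat l (m - l) \<and> S' \<in> carrier_mat (m - l) (m - l) \<and>
     unitary_mat (hcat V V') \<and>
     upper_triangular (four_block_mat S Sx (0\<^sub>m (m - l) l) S') \<and>
     H * hcat V V' = hcat V V' * four_block_mat S Sx (0\<^sub>m (m - l) l) S'"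

definition partial_schur ::
  "complex mat \<Rightarrow> nat \<Rightarrow> nat \<Rightarrow> complex mat \<Rightarrow> complex mat \<Rightarrow> bool"
where
  "partial_schur G m l V S \<longleftrightarrow>
     V \<in> carrier_mat m l \<and> S \<in> carrier_mat l l \<and>
     orthonormal_cols V \<and> upper_triangular S \<and> G * V = V * S"

definition krylov_decomp ::
  "complex mat \<Rightarrow> nat \<Rightarrow> nat \<Rightarrow> complex mat \<Rightarrow> complex mat \<Rightarrow> complex vec \<Rightarrow> complex vec \<Rightarrow> bool"
where
  "krylov_decomp A n m U H u c \<longleftrightarrow>
     U \<in> carrier_mat n m \<and> H \<in> carrier_mat m m \<and> u \<in> carrier_vec n \<and> c \<in> carrier_vec m \<and>
     A * U = U * H + outer_prod u c"

text \<open>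
  The relation \<open>A Q = Q G + u d\<^sup>H\<close> and \<open>Q\<^sup>H u = 0\<close> are not part of the definition: they follow
  from \<open>A U = U H + u c\<^sup>H\<close> and \<open>U\<^sup>H u = 0\<close>.  The residual vector \<open>u\<close> is shared by both
  decompositions.
\<close>

definition assoc_orthonormal ::
  "complex mat \<Rightarrow> complex mat \<Rightarrow> complex vec \<Rightarrow> complex mat \<Rightarrow> complex mat \<Rightarrow> complex vec \<Rightarrow> bool"
where
  "assoc_orthonormal A U c Q G d \<longleftrightarrow>
     Q \<in> carrier_mat (dim_row U) (dim_col U) \<and> orthonormal_cols Q \<and> range_mat Q = range_mat U \<and>
     G = mat_adjoint Q * A * Q \<and>
     d = the (mat_inverse (mat_adjoint (mat_adjoint Q * U))) *\<^sub>v c"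

text \<open>
  Both Arnoldi processes are instances of one scheme.  The list \<open>us\<close> holds the basis vectors
  \<open>u\<^sub>1, \<dots>, u\<^sub>k\<close>; \<open>cf U w\<close> is the coefficient vector \<open>h\<^sub>k\<close> used to orthogonalize \<open>w = A u\<^sub>k\<close>
  against the columns of \<open>U\<close>, and \<open>nf\<close> is the norm used for the normalization.
\<close>

type_synonym coeff_rule = "complex mat \<Rightarrow> complex vec \<Rightarrow> complex vec"
type_synonym norm_rule = "complex vec \<Rightarrow> real"

definition arnoldi_coeff :: "coeff_rule \<Rightarrow> complex mat \<Rightarrow> complex vec list \<Rightarrow> complex vec" where
  "arnoldi_coeff cf A us = cf (mat_of_cols (dim_row A) us) (A *\<^sub>v last us)"

definition arnoldi_residual :: "coeff_rule \<Rightarrow> complex mat \<Rightarrow> complex vec list \<Rightarrow> complex vec" where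
  "arnoldi_residual cf A us =
     A *\<^sub>v last us - mat_of_cols (dim_row A) us *\<^sub>v arnoldi_coeff cf A us"

fun arnoldi_basis ::
  "coeff_rule \<Rightarrow> norm_rule \<Rightarrow> complex mat \<Rightarrow> complex vec list \<Rightarrow> nat \<Rightarrow> complex vec list"
where
  "arnoldi_basis cf nf A us 0 = us"
| "arnoldi_basis cf nf A us (Suc k) =
     (let vs = arnoldi_basis cf nf A us k; r = arnoldi_residual cf A vs
      in vs @ [(1 / complex_of_real (nf r)) \<cdot>\<^sub>v r])"

text \<open>The vectors before normalization; absence of breakdown means that none of them is zero.\<close>

definition arnoldi_residuals ::
  "coeff_rule \<Rightarrow> norm_rule \<Rightarrow> complex mat \<Rightarrow> complex vec list \<Rightarrow> nat \<Rightarrow> complex vec list"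
where
  "arnoldi_residuals cf nf A us s =
     map (\<lambda>k. arnoldi_residual cf A (arnoldi_basis cf nf A us k)) [0..<s]"

text \<open>
  Expansion of \<open>A U = U H + u c\<^sup>H\<close> (order \<open>l\<close>) to order \<open>m\<close>.  The result \<open>(U\<^sub>m, H\<^sub>m, g, u\<^sub>m\<^sub>+\<^sub>1)\<close>
  represents \<open>A U\<^sub>m = U\<^sub>m H\<^sub>m + g u\<^sub>m\<^sub>+\<^sub>1 e\<^sub>m\<^sup>H\<close>, where \<open>g\<close> is the last normalization factor.
  Indices are 0-based: column \<open>j \<ge> l\<close> of \<open>H\<^sub>m\<close> comes from the step that starts with the
  \<open>j + 1\<close> vectors \<open>arnoldi_basis cf nf A us (j - l)\<close>.
\<close>

definition arnoldi_expand ::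
  "coeff_rule \<Rightarrow> norm_rule \<Rightarrow> complex mat \<Rightarrow> nat \<Rightarrow>
   complex mat \<Rightarrow> complex mat \<Rightarrow> complex vec \<Rightarrow> complex vec \<Rightarrow>
   complex mat \<times> complex mat \<times> real \<times> complex vec"
where
  "arnoldi_expand cf nf A m U H u c =
     (let l = dim_col U; us = cols U @ [u]; vs = arnoldi_basis cf nf A us (m - l) in
      (mat_of_cols (dim_row A) (take m vs),
       mat m m (\<lambda>(i, j).
         if j < l then
           (if i < l then H $$ (i, j) else if i = l then conjugate (c $ j) else 0)
         else let ws = arnoldi_basis cf nf A us (j - l) in
           (if i \<le> j then arnoldi_coeff cf A ws $ i
            else if i = Suc j then complex_of_real (nf (arnoldi_residual cf A ws)) else 0)),
       nf (arnoldi_residual cf A (arnoldi_basis cf nf A us (m - l - 1))),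
       last vs))"

definition sketch_coeff :: "complex mat \<Rightarrow> coeff_rule" where
  "sketch_coeff \<Omega> U w = pinv (\<Omega> * U) *\<^sub>v (\<Omega> *\<^sub>v w)"

definition sketch_norm :: "complex mat \<Rightarrow> norm_rule" where
  "sketch_norm \<Omega> x = cvec_norm (\<Omega> *\<^sub>v x)"

definition gs_coeff :: coeff_rule where
  "gs_coeff Q w = mat_adjoint Q *\<^sub>v w"

text \<open>
  One cycle of the similarity-restoring randomized Krylov--Schur method, started from the
  decomposition with data \<open>U, u, c\<close> and the leading part \<open>V, S\<close> of the Schur decomposition:
  compression, randomized expansion to order \<open>m = dim_col U\<close>, and correction.  The value is
  \<open>(U\<^sup>n\<^sup>e\<^sup>w, H\<^sup>n\<^sup>e\<^sup>w, u\<^sup>n\<^sup>e\<^sup>w, c\<^sup>n\<^sup>e\<^sup>w)\<close> after the correction.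
\<close>

definition rks_cycle ::
  "complex mat \<Rightarrow> complex mat \<Rightarrow> complex mat \<Rightarrow> complex vec \<Rightarrow> complex vec \<Rightarrow>
   complex mat \<Rightarrow> complex mat \<Rightarrow>
   complex mat \<times> complex mat \<times> complex vec \<times> complex vec"
where
  "rks_cycle A \<Omega> U u c V S =
     (let m = dim_col U;
          (Um, Hm, g, um) = arnoldi_expand (sketch_coeff \<Omega>) (sketch_norm \<Omega>) A m
                              (U * V) S u (mat_adjoint V *\<^sub>v c);
          cm = complex_of_real g \<cdot>\<^sub>v unit_vec m (m - 1);
          h = pinv Um *\<^sub>v um
      in (Um, Hm + outer_prod h cm, um - Um *\<^sub>v h, cm))"

definition rks_start :: "complex mat \<Rightarrow> complex vec \<Rightarrow> complex mat \<Rightarrow> complex vec list" where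
  "rks_start U u V = cols (U * V) @ [u]"

definition rks_residuals ::
  "complex mat \<Rightarrow> complex mat \<Rightarrow> complex mat \<Rightarrow> complex vec \<Rightarrow> complex mat \<Rightarrow> complex vec list"
where
  "rks_residuals A \<Omega> U u V =
     arnoldi_residuals (sketch_coeff \<Omega>) (sketch_norm \<Omega>) A (rks_start U u V) (dim_col U - dim_col V)"

text \<open>
  The span of all basis vectors \<open>u\<^sub>1, \<dots>, u\<^sub>m\<^sub>+\<^sub>1\<close> of the cycle.  The unnormalized vectors are
  listed as well because of \<open>1 / 0 = 0\<close>: were \<open>\<Omega> r = 0\<close> for some such \<open>r \<noteq> 0\<close>, the
  corresponding basis vector would be \<open>0\<close> and the embedding property would not exclude this case.
  Otherwise they do not enlarge the span.
\<close>

definition rks_space ::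
  "complex mat \<Rightarrow> complex mat \<Rightarrow> complex mat \<Rightarrow> complex vec \<Rightarrow> complex mat \<Rightarrow> complex vec set"
where
  "rks_space A \<Omega> U u V = cspan (dim_row A)
     (set (arnoldi_basis (sketch_coeff \<Omega>) (sketch_norm \<Omega>) A (rks_start U u V)
             (dim_col U - dim_col V))
      \<union> set (rks_residuals A \<Omega> U u V))"

text \<open>
  Standard Arnoldi expansion of \<open>A Q V = Q V S + u d\<^sup>H V\<close> to order \<open>m = dim_col Q\<close>.  Since the
  appended vector is \<open>u / \<parallel>u\<parallel>\<close>, the factor \<open>\<parallel>u\<parallel>\<close> goes into \<open>V\<^sup>H d\<close>.
\<close>

definition std_start :: "complex vec \<Rightarrow> complex vec" where
  "std_start u = (1 / complex_of_real (cvec_norm u)) \<cdot>\<^sub>v u"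

definition std_expand ::
  "complex mat \<Rightarrow> complex mat \<Rightarrow> complex vec \<Rightarrow> complex vec \<Rightarrow> complex mat \<Rightarrow> complex mat \<Rightarrow>
   complex mat \<times> complex mat \<times> real \<times> complex vec \<times> complex vec"
where
  "std_expand A Q u d V S =
     (let m = dim_col Q;
          (Qm, Gm, g, q) = arnoldi_expand gs_coeff cvec_norm A m (Q * V) S (std_start u)
                             (complex_of_real (cvec_norm u) \<cdot>\<^sub>v (mat_adjoint V *\<^sub>v d))
      in (Qm, Gm, g, q, unit_vec m (m - 1)))"

definition std_residuals ::
  "complex mat \<Rightarrow> complex mat \<Rightarrow> complex vec \<Rightarrow> complex mat \<Rightarrow> complex vec list"
where
  "std_residuals A Q u V =
     arnoldi_residuals gs_coeff cvec_norm A (cols (Q * V) @ [std_start u]) (dim_col Q - dim_col V)"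

end

theory Submission
  imports Defs
begin

text \<open>
  Both Arnoldi processes replace the span \<open>X\<close> of the current basis by \<open>X + A X\<close>, whatever
  coefficients and normalization factors they use, so they produce the same subspaces once they
  start from the same ones.  The starting subspaces agree: with \<open>P = Q\<^sup>H U\<close> (for the old \<open>Q\<close>,
  \<open>U\<close>, \<open>G\<close>, \<open>H\<close>) one has \<open>U = Q P\<close> and \<open>G P = P H\<close>, so for \<open>W = P\<inverse> V\<^sub>t\<close> the component
  \<open>Z = V'\<^sup>H W\<close> solves the Sylvester equation \<open>S' Z = Z S\<^sub>t\<close>.  It has only the zero solution,
  because \<open>S'\<close> and \<open>S\<^sub>t\<close> have no common eigenvalue, and hence \<open>W\<close> and \<open>V\<close> have the same range.
  The embedding property keeps the sketched basis linearly independent, so each pseudoinverse is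
  the usual left inverse \<open>(M\<^sup>H M)\<inverse> M\<^sup>H\<close>.  Finally \<open>q\<^sub>t\<close> and the new residual vector both span the
  orthogonal complement of the common \<open>m\<close>-dimensional space in the common
  \<open>m + 1\<close>-dimensional one.
\<close>

section \<open>Adjoints, injectivity, ranges and the pseudoinverse\<close>

lemma mat_adjoint_carrier [simp]: "mat_adjoint M \<in> carrier_mat (dim_col M) (dim_row M)"
  unfolding mat_adjoint_def by (rule carrier_matI) simp_all

lemma mat_adjoint_dim [simp]:
  "dim_row (mat_adjoint M) = dim_col M" "dim_col (mat_adjoint M) = dim_row M"
  unfolding mat_adjoint_def by simp_all

lemma mat_adjoint_index [simp]:
  "i < dim_col M \<Longrightarrow> j < dim_row M \<Longrightarrow> mat_adjoint M $$ (i, j) = conjugate (M $$ (j, i))"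
  unfolding mat_adjoint_def by (simp add: mat_of_rows_index)

lemma mat_adjoint_adjoint [simp]: "mat_adjoint (mat_adjoint M) = M"
  by (rule eq_matI) auto

lemma mat_adjoint_one [simp]: "mat_adjoint (1\<^sub>m n :: complex mat) = 1\<^sub>m n"
  by (rule eq_matI) auto

lemma mat_adjoint_mult:
  fixes M N :: "complex mat"
  assumes "dim_col M = dim_row N"
  shows "mat_adjoint (M * N) = mat_adjoint N * mat_adjoint M"
  using assms by (intro eq_matI) (auto simp: scalar_prod_def mult.commute)

lemma cscalar_prod_mult_mat_vec:
  fixes M :: "complex mat"
  assumes "x \<in> carrier_vec (dim_row M)" "y \<in> carrier_vec (dim_col M)"
  shows "x \<bullet>c (M *\<^sub>v y) = (mat_adjoint M *\<^sub>v x) \<bullet>c y"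
proof -
  have "x \<bullet>c (M *\<^sub>v y) = (\<Sum>i = 0..<dim_row M. \<Sum>j = 0..<dim_col M. x $ i * cnj (M $$ (i, j)) * cnj (y $ j))"
    using assms by (auto simp: scalar_prod_def sum_distrib_left mult.assoc intro!: sum.cong)
  also have "\<dots> = (\<Sum>j = 0..<dim_col M. \<Sum>i = 0..<dim_row M. x $ i * cnj (M $$ (i, j)) * cnj (y $ j))"
    by (rule sum.swap)
  also have "\<dots> = (mat_adjoint M *\<^sub>v x) \<bullet>c y"
    using assms by (auto simp: scalar_prod_def sum_distrib_left sum_distrib_right mult_ac intro!: sum.cong)
  finally show ?thesis .
qed

text \<open>By adjointness \<open>M y\<close> is orthogonal to itself. In effect the range of a
  matrix meets the kernel of its adjoint only in 0, which is the form in which this is used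
  below.\<close>

lemma mult_mat_vec_eq_0_if_adjoint:
  fixes M :: "complex mat"
  assumes y: "y \<in> carrier_vec (dim_col M)" and 0: "mat_adjoint M *\<^sub>v (M *\<^sub>v y) = 0\<^sub>v (dim_col M)"
  shows "M *\<^sub>v y = 0\<^sub>v (dim_row M)"
proof -
  have "(M *\<^sub>v y) \<bullet>c (M *\<^sub>v y) = 0"
    using y 0 by (subst cscalar_prod_mult_mat_vec) (auto intro: carrier_vecI)
  then show ?thesis by (subst (asm) conjugate_square_eq_0_vec) (auto intro: carrier_vecI)
qed

text \<open>Full column rank, phrased as a trivial kernel. In this form it passes through products
  and appended columns without counting dimensions.\<close>

definition injective_mat :: "complex mat \<Rightarrow> bool" where
  "injective_mat M \<longleftrightarrow>
     (\<forall>x \<in> carrier_vec (dim_col M). M *\<^sub>v x = 0\<^sub>v (dim_row M) \<longrightarrow> x = 0\<^sub>v (dim_col M))"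

lemma injective_mat_inverse:
  assumes "injective_mat M" "M \<in> carrier_mat n n"
  obtains N where "N \<in> carrier_mat n n" "M * N = 1\<^sub>m n" "N * M = 1\<^sub>m n"
proof -
  have "det M \<noteq> 0"
    using assms by (subst det_0_iff_vec_prod_zero[OF assms(2)]) (auto simp: injective_mat_def)
  from det_non_zero_imp_unit[OF assms(2) this, of "()"] show ?thesis
    using that by (auto simp: Units_def ring_mat_def)
qed

lemma orthonormal_cols_injective: "orthonormal_cols Q \<Longrightarrow> injective_mat Q"
  unfolding injective_mat_def orthonormal_cols_def
proof (intro ballI impI)
  fix x assume Q: "mat_adjoint Q * Q = 1\<^sub>m (dim_col Q)" and x: "x \<in> carrier_vec (dim_col Q)"
    and 0: "Q *\<^sub>v x = 0\<^sub>v (dim_row Q)"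
  have "x = (mat_adjoint Q * Q) *\<^sub>v x" using Q x by simp
  also have "\<dots> = mat_adjoint Q *\<^sub>v (Q *\<^sub>v x)"
    using x by (intro assoc_mult_mat_vec) auto
  finally show "x = 0\<^sub>v (dim_col Q)" using 0 by auto
qed

text \<open>\<open>rank\<close> and linear independence speak of the set of columns, so repeated
  columns are excluded first: they would push the rank below \<open>dim_col U\<close>. After that a
  kernel vector is a vanishing linear combination of independent columns.\<close>

lemma full_col_rank_injective:
  assumes "full_col_rank U"
  shows "injective_mat U"
  unfolding injective_mat_def
proof (intro ballI impI)
  fix x assume x: "x \<in> carrier_vec (dim_col U)" and 0: "U *\<^sub>v x = 0\<^sub>v (dim_row U)"
  interpret vec_space "TYPE(complex)" "dim_row U" .
  have U: "U \<in> carrier_mat (dim_row U) (dim_col U)" by simp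
  have r: "rank U = dim_col U" using assms by (simp add: full_col_rank_def)
  have d: "distinct (cols U)" 
  proof -
    obtain S where S: "maximal S (\<lambda>T. T \<subseteq> set (cols U) \<and> lin_indpt T)"
      using maximal_exists[of "\<lambda>T. T \<subseteq> set (cols U) \<and> lin_indpt T" "card (set (cols U))" "{}"]
      by (meson List.finite_set card_mono empty_iff empty_subsetI finite_lin_indpt2 rev_finite_subset)
    then have "card S \<le> card (set (cols U))" by (simp add: card_mono maximal_def)
    then have "length (cols U) \<le> card (set (cols U))" using rank_card_indpt[OF U S] r by simp
    then show ?thesis using card_length[of "cols U"] by (intro card_distinct) simp
  qed
  \<comment> \<open>Linear combinations take coefficients indexed by vectors, not by positions.
    Since the columns are distinct, each entry of \<open>x\<close> can be attached to its
    column.\<close>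
  define a where "a v = x $ (THE i. i < dim_col U \<and> col U i = v)" for v
  have a: "a (col U i) = x $ i" if "i < dim_col U" for i
  proof -
    have "(THE j. j < dim_col U \<and> col U j = col U i) = i"
      using that d by (intro the_equality) (auto simp: distinct_conv_nth)
    then show ?thesis by (simp add: a_def)
  qed
  have "x = vec (dim_col U) (\<lambda>i. a (col U i))"
    using x by (intro eq_vecI) (auto simp: a)
  then have "lincomb a (set (cols U)) = 0\<^sub>v (dim_row U)"
    using mat_mult_eq_lincomb[OF U d, of a] 0 by simp
  moreover have "finite (set (cols U))" "a \<in> set (cols U) \<rightarrow> UNIV" by auto
  ultimately have "a v = 0" if "v \<in> set (cols U)" for v
    using that full_rank_lin_indpt[OF U r d] unfolding lin_dep_def
    by (simp, blast)
  then have "x $ i = 0" if "i < dim_col U" for i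
    using that a[OF that] by (metis cols_length cols_nth nth_mem)
  then show "x = 0\<^sub>v (dim_col U)" using x by (intro eq_vecI) auto
qed

lemma range_mat_eq: "range_mat M = (\<lambda>x. M *\<^sub>v x) ` carrier_vec (dim_col M)"
proof -
  interpret vec_space "TYPE(complex)" "dim_row M" .
  show ?thesis by (subst col_space_eq[of M "dim_col M"]) (auto intro: carrier_vecI)
qed

lemma cspan_eq_range_mat:
  assumes "set us \<subseteq> carrier_vec n"
  shows "cspan n (set us) = range_mat (mat_of_cols n us)"
proof -
  interpret vec_space "TYPE(complex)" n .
  show ?thesis using assms by (simp add: col_space_def)
qed

lemma range_mat_cols: "M \<in> carrier_mat n k \<Longrightarrow> range_mat M = cspan n (set (cols M))"
  by (subst cspan_eq_range_mat) (use cols_dim[of M] in auto)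

text \<open>The squared norm of \<open>?y\<close> is the inner product of \<open>q\<close> with
  \<open>N ?y\<close>, a vector in the range of \<open>M\<close>, to which \<open>q\<close> is
  orthogonal. Hence orthogonality to the columns depends only on the subspace and can be moved from
  one basis to another.\<close>

lemma adjoint_kernel_cong:
  assumes M: "M \<in> carrier_mat n k" and N: "N \<in> carrier_mat n j"
    and sub: "range_mat N \<subseteq> range_mat M" and q: "q \<in> carrier_vec n"
    and 0: "mat_adjoint M *\<^sub>v q = 0\<^sub>v k"
  shows "mat_adjoint N *\<^sub>v q = 0\<^sub>v j"
proof -
  let ?y = "mat_adjoint N *\<^sub>v q"
  have y: "?y \<in> carrier_vec j" using N q mult_mat_vec_carrier[OF mat_adjoint_carrier, of q N] by auto
  have "N *\<^sub>v ?y \<in> range_mat M" using y sub N unfolding range_mat_eq by auto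
  then obtain x where x: "x \<in> carrier_vec k" "N *\<^sub>v ?y = M *\<^sub>v x"
    using M unfolding range_mat_eq by auto
  have "?y \<bullet>c ?y = q \<bullet>c (N *\<^sub>v ?y)" using N q y by (subst cscalar_prod_mult_mat_vec) auto
  also have "\<dots> = q \<bullet>c (M *\<^sub>v x)" using x by simp
  also have "\<dots> = 0" using M q x 0 by (subst cscalar_prod_mult_mat_vec) auto
  finally show ?thesis using y by simp
qed

text \<open>\<open>pinv\<close> is a definite description, so it is accessible only after one
  solution of the Penrose equations is exhibited and shown to be unique. The solution is
  \<open>X = K * ?M\<close>, where \<open>K\<close> inverts the Gram matrix
  \<open>?M * M\<close>.\<close>

lemma pinv_injective:
  assumes inj: "injective_mat M"
  shows pinv_carrier: "pinv M \<in> carrier_mat (dim_col M) (dim_row M)"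
    and pinv_mult: "pinv M * M = 1\<^sub>m (dim_col M)"
    and adjoint_mult_pinv: "mat_adjoint (M * pinv M) = M * pinv M"
proof -
  let ?a = "dim_row M" and ?b = "dim_col M"
  have M: "M \<in> carrier_mat ?a ?b" by simp
  let ?M = "mat_adjoint M"
  have M': "?M \<in> carrier_mat ?b ?a" by simp
  have "injective_mat (?M * M)" unfolding injective_mat_def
  proof (intro ballI impI)
    fix x assume x: "x \<in> carrier_vec (dim_col (?M * M))"
      and 0: "?M * M *\<^sub>v x = 0\<^sub>v (dim_row (?M * M))"
    have "?M *\<^sub>v (M *\<^sub>v x) = 0\<^sub>v ?b" using x 0 assoc_mult_mat_vec[OF M' M, of x] by simp
    then have "M *\<^sub>v x = 0\<^sub>v ?a" using x by (intro mult_mat_vec_eq_0_if_adjoint) auto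
    then show "x = 0\<^sub>v (dim_col (?M * M))" using inj x by (auto simp: injective_mat_def)
  qed
  moreover have N: "?M * M \<in> carrier_mat ?b ?b" by (rule mult_carrier_mat[OF M' M])
  ultimately obtain K where K: "K \<in> carrier_mat ?b ?b"
      "(?M * M) * K = 1\<^sub>m ?b" "K * (?M * M) = 1\<^sub>m ?b"
    by (rule injective_mat_inverse)
  \<comment> \<open>The Gram matrix is Hermitian, so the adjoint of its right inverse is a left
    inverse. The two coincide, and \<open>K\<close> is Hermitian.\<close>
  have "mat_adjoint K * (?M * M) = mat_adjoint ((?M * M) * K)"
    using K(1) by (simp add: mat_adjoint_mult)
  then have K': "mat_adjoint K * (?M * M) = 1\<^sub>m ?b" using K by simp
  have KH: "mat_adjoint K \<in> carrier_mat ?b ?b" using K(1) mat_adjoint_carrier[of K] by auto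
  have herm: "mat_adjoint K = K"
    using assoc_mult_mat[OF KH N K(1)] K K' KH by simp
  define X where "X = K * ?M"
  have X: "X \<in> carrier_mat ?b ?a" unfolding X_def using K by auto
  have XM: "X * M = 1\<^sub>m ?b" unfolding X_def using assoc_mult_mat[OF K(1) M' M] K by simp
  have MX: "mat_adjoint (M * X) = M * X"
  proof -
    have "mat_adjoint (M * X) = (M * mat_adjoint K) * ?M"
      using K(1) unfolding X_def by (simp add: mat_adjoint_mult)
    also have "\<dots> = M * (K * ?M)" unfolding herm using assoc_mult_mat[OF M K(1) M'] .
    finally show ?thesis by (simp add: X_def)
  qed
  let ?P = "\<lambda>X. X \<in> carrier_mat ?b ?a \<and> M * X * M = M \<and> X * M * X = X \<and>
     mat_adjoint (M * X) = M * X \<and> mat_adjoint (X * M) = X * M"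
  have "?P X" using X XM MX assoc_mult_mat[OF M X M] by simp
  moreover have "Y = X" if Y: "?P Y" for Y
  proof -
    from Y have Yc: "Y \<in> carrier_mat ?b ?a" and 1: "M * Y * M = M" and 2: "Y * M * Y = Y"
      and 3: "mat_adjoint (M * Y) = M * Y" by auto
    have MY: "M * Y \<in> carrier_mat ?a ?a" "M * X \<in> carrier_mat ?a ?a" using Yc X by auto
    have "Y * M = X * M * (Y * M)" using XM Yc by simp
    also have "\<dots> = X * (M * Y * M)"
      using assoc_mult_mat[OF X M mult_carrier_mat[OF Yc M]] assoc_mult_mat[OF M Yc M] by simp
    finally have YM: "Y * M = 1\<^sub>m ?b" using 1 XM by simp
    \<comment> \<open>This writes \<open>M * X\<close> as \<open>(M * Y) * (M * X)\<close>. All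
      these products are Hermitian, so taking adjoints swaps the factors, and
      \<open>X * M = 1\<close> then leaves \<open>M * Y\<close>.\<close>
    have "M * X = (M * Y * M) * X" using 1 by simp
    also have "\<dots> = (M * Y) * (M * X)" using assoc_mult_mat[OF MY(1) M X] by simp
    finally have "mat_adjoint (M * X) = mat_adjoint ((M * Y) * (M * X))" by simp
    also have "\<dots> = (M * X) * (M * Y)" using MX 3 MY by (subst mat_adjoint_mult) auto
    also have "\<dots> = M * (X * M) * Y"
      using assoc_mult_mat[OF MY(2) M Yc] assoc_mult_mat[OF M X M] by simp
    finally have eq: "M * X = M * Y" using MX XM by simp
    have "Y = X * M * Y" using XM Yc by simp
    also have "\<dots> = X * (M * X)" using assoc_mult_mat[OF X M Yc] eq by simp
    also have "\<dots> = X" using assoc_mult_mat[OF X M X] XM X by simp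
    finally show ?thesis .
  qed
  ultimately have eq: "pinv M = X" unfolding pinv_def by (rule the_equality)
  show "pinv M \<in> carrier_mat ?b ?a" unfolding eq by (rule X)
  show "pinv M * M = 1\<^sub>m ?b" unfolding eq by (rule XM)
  show "mat_adjoint (M * pinv M) = M * pinv M" unfolding eq by (rule MX)
qed

text \<open>\<open>M * pinv M\<close> is Hermitian and fixes \<open>M\<close>, so it is the
  orthogonal projector onto the range. The lemma serves twice: with a sketched basis in every
  randomized step, and with the unsketched basis in the final correction.\<close>

lemma adjoint_pinv_residual:
  assumes inj: "injective_mat M" and y: "y \<in> carrier_vec (dim_row M)"
  shows "mat_adjoint M *\<^sub>v (y - M *\<^sub>v (pinv M *\<^sub>v y)) = 0\<^sub>v (dim_col M)"
proof -
  note p = pinv_injective[OF inj]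
  have M: "M \<in> carrier_mat (dim_row M) (dim_col M)" by simp
  have "mat_adjoint M * (M * pinv M) = mat_adjoint (M * pinv M * M)"
    using p by (subst mat_adjoint_mult) auto
  also have "\<dots> = mat_adjoint M" using assoc_mult_mat[OF M p(1) M] p(2) by simp
  finally have eq: "mat_adjoint M * (M * pinv M) = mat_adjoint M" .
  have "mat_adjoint M *\<^sub>v (M *\<^sub>v (pinv M *\<^sub>v y)) = mat_adjoint M *\<^sub>v y"
    using assoc_mult_mat_vec[OF M p(1) y]
      assoc_mult_mat_vec[OF mat_adjoint_carrier mult_carrier_mat[OF M p(1)] y] eq by simp
  then show ?thesis
    using y by (subst mult_minus_distrib_mat_vec[of _ "dim_col M" "dim_row M"])
      (auto intro: carrier_vecI)
qed

section \<open>Spans of Arnoldi bases\<close>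

lemma cspan_mono: "S \<subseteq> T \<Longrightarrow> cspan n S \<subseteq> cspan n T"
proof -
  interpret vec_space "TYPE(complex)" n .
  assume "S \<subseteq> T" then show ?thesis by (rule span_is_monotone)
qed

lemma cspan_superset: "S \<subseteq> carrier_vec n \<Longrightarrow> S \<subseteq> cspan n S"
proof -
  interpret vec_space "TYPE(complex)" n .
  assume "S \<subseteq> carrier_vec n" then show ?thesis by (intro in_own_span) auto
qed

lemma cspan_carrier: "S \<subseteq> carrier_vec n \<Longrightarrow> cspan n S \<subseteq> carrier_vec n"
proof -
  interpret vec_space "TYPE(complex)" n .
  assume "S \<subseteq> carrier_vec n" then show ?thesis using span_is_subset2 by auto
qed

lemma cspan_least: "T \<subseteq> carrier_vec n \<Longrightarrow> S \<subseteq> cspan n T \<Longrightarrow> cspan n S \<subseteq> cspan n T"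
proof -
  interpret vec_space "TYPE(complex)" n .
  assume "T \<subseteq> carrier_vec n" "S \<subseteq> cspan n T" then show ?thesis by (rule span_subsetI)
qed

lemma cspan_add:
  assumes "T \<subseteq> carrier_vec n" "x \<in> cspan n T" "y \<in> cspan n T"
  shows "x + y \<in> cspan n T"
proof -
  interpret vec_space "TYPE(complex)" n .
  show ?thesis using span_add1 assms by auto
qed

lemma cspan_smult:
  assumes "T \<subseteq> carrier_vec n" "x \<in> cspan n T"
  shows "c \<cdot>\<^sub>v x \<in> cspan n T"
proof -
  interpret vec_space "TYPE(complex)" n .
  show ?thesis using smult_in_span assms by auto
qed

lemma cspan_diff:
  assumes "T \<subseteq> carrier_vec n" "x \<in> cspan n T" "y \<in> cspan n T"
  shows "x - y \<in> cspan n T"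
proof -
  have "x - y = x + (- 1) \<cdot>\<^sub>v y"
    using assms cspan_carrier[OF assms(1)] by (intro eq_vecI) auto
  then show ?thesis using assms cspan_add cspan_smult by simp
qed

lemma mult_mat_of_cols_cspan:
  assumes "set us \<subseteq> carrier_vec n" "x \<in> carrier_vec (length us)"
  shows "mat_of_cols n us *\<^sub>v x \<in> cspan n (set us)"
  unfolding cspan_eq_range_mat[OF assms(1)] range_mat_eq using assms by auto

lemma cspan_elem:
  assumes "set us \<subseteq> carrier_vec n" "x \<in> cspan n (set us)"
  obtains y where "y \<in> carrier_vec (length us)" "x = mat_of_cols n us *\<^sub>v y"
  using assms(2) unfolding cspan_eq_range_mat[OF assms(1)] range_mat_eq by auto

lemma mult_mat_vec_cspan:
  assumes A: "A \<in> carrier_mat n n" and us: "set us \<subseteq> carrier_vec n" and T: "T \<subseteq> carrier_vec n"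
    and im: "\<And>u. u \<in> set us \<Longrightarrow> A *\<^sub>v u \<in> cspan n T" and x: "x \<in> cspan n (set us)"
  shows "A *\<^sub>v x \<in> cspan n T"
proof -
  let ?M = "mat_of_cols n us"
  obtain y where y: "y \<in> carrier_vec (length us)" "x = ?M *\<^sub>v y"
    using cspan_elem[OF us x] .
  have M: "?M \<in> carrier_mat n (length us)" by simp
  have AM: "A * ?M \<in> carrier_mat n (length us)" using A M by (rule mult_carrier_mat)
  have "set (cols (A * ?M)) \<subseteq> cspan n T"
  proof
    fix c assume "c \<in> set (cols (A * ?M))"
    then obtain i where i: "i < length us" "c = col (A * ?M) i"
      using AM by (auto simp: cols_def)
    then have "c = A *\<^sub>v (us ! i)"
      using us nth_mem[OF i(1)] by (subst i(2), subst col_mult2[OF A M i(1)], subst col_mat_of_cols) auto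
    then show "c \<in> cspan n T" using im i by simp
  qed
  then have "range_mat (A * ?M) \<subseteq> cspan n T"
    unfolding range_mat_cols[OF AM] using T by (intro cspan_least)
  moreover have "A *\<^sub>v x = (A * ?M) *\<^sub>v y"
    using assoc_mult_mat_vec[OF A M y(1)] y(2) by simp
  then have "A *\<^sub>v x \<in> range_mat (A * ?M)"
    unfolding range_mat_eq using y(1) AM by auto
  ultimately show ?thesis by blast
qed

lemma mat_of_cols_snoc_mult:
  fixes r :: "complex vec"
  assumes us: "set us \<subseteq> carrier_vec n" and r: "r \<in> carrier_vec n"
    and z: "z \<in> carrier_vec (Suc (length us))"
  shows "mat_of_cols n (us @ [r]) *\<^sub>v z =
    mat_of_cols n us *\<^sub>v vec (length us) (\<lambda>i. z $ i) + (z $ length us) \<cdot>\<^sub>v r"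
proof (rule eq_vecI)
  let ?R = "mat_of_cols n us *\<^sub>v vec (length us) (\<lambda>i. z $ i) + (z $ length us) \<cdot>\<^sub>v r"
  fix i assume "i < dim_vec ?R"
  then have i: "i < n" using r by simp
  have "(mat_of_cols n (us @ [r]) *\<^sub>v z) $ i = (\<Sum>j = 0..<length us. us ! j $ i * z $ j) + r $ i * z $ length us"
    using i z by (simp add: scalar_prod_def mat_of_cols_index nth_append)
  also have "\<dots> = ?R $ i"
    using i r by (simp add: scalar_prod_def mat_of_cols_index mult.commute[of "r $ i"])
  finally show "(mat_of_cols n (us @ [r]) *\<^sub>v z) $ i = ?R $ i" .
qed (use r in simp)

text \<open>A nonzero coefficient of \<open>r\<close> in a vanishing combination would express
  \<open>r\<close> through \<open>us\<close>.\<close>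

lemma injective_mat_snoc:
  assumes us: "set us \<subseteq> carrier_vec n" and r: "r \<in> carrier_vec n"
    and inj: "injective_mat (mat_of_cols n us)" and notin: "r \<notin> cspan n (set us)"
  shows "injective_mat (mat_of_cols n (us @ [r]))"
  unfolding injective_mat_def
proof (intro ballI impI)
  fix z assume "z \<in> carrier_vec (dim_col (mat_of_cols n (us @ [r])))"
    and 0: "mat_of_cols n (us @ [r]) *\<^sub>v z = 0\<^sub>v (dim_row (mat_of_cols n (us @ [r])))"
  then have z: "z \<in> carrier_vec (Suc (length us))" by simp
  define y where "y = vec (length us) (\<lambda>i. z $ i)"
  define t where "t = z $ length us"
  have y: "y \<in> carrier_vec (length us)" by (simp add: y_def)
  have My: "mat_of_cols n us *\<^sub>v y \<in> carrier_vec n" by (auto intro: carrier_vecI)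
  have sum: "mat_of_cols n us *\<^sub>v y + t \<cdot>\<^sub>v r = 0\<^sub>v n"
    using 0 mat_of_cols_snoc_mult[OF us r z] by (simp add: y_def t_def)
  have "t = 0"
  proof (rule ccontr)
    assume t: "t \<noteq> 0"
    have "r = (- 1 / t) \<cdot>\<^sub>v (mat_of_cols n us *\<^sub>v y)"
    proof (rule eq_vecI)
      fix i assume "i < dim_vec ((- 1 / t) \<cdot>\<^sub>v (mat_of_cols n us *\<^sub>v y))"
      then have i: "i < n" by simp
      have "(mat_of_cols n us *\<^sub>v y + t \<cdot>\<^sub>v r) $ i = 0" using sum i by simp
      then have "(mat_of_cols n us *\<^sub>v y) $ i + t * r $ i = 0" using i r by simp
      then have "r $ i = (- 1 / t) * (mat_of_cols n us *\<^sub>v y) $ i"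
        using t by (simp add: field_simps add_eq_0_iff)
      then show "r $ i = ((- 1 / t) \<cdot>\<^sub>v (mat_of_cols n us *\<^sub>v y)) $ i" using i by simp
    qed (use r in simp)
    then show False
      using notin cspan_smult[OF us mult_mat_of_cols_cspan[OF us y]] by metis
  qed
  then have "t \<cdot>\<^sub>v r = 0\<^sub>v n" using r by auto
  then have "mat_of_cols n us *\<^sub>v y = 0\<^sub>v n" using sum My by simp
  then have "y = 0\<^sub>v (length us)" using inj y by (simp add: injective_mat_def)
  then have "z $ i = 0" if "i < length us" for i
    using that by (metis index_vec index_zero_vec(1) y_def)
  then have "z $ i = 0" if "i < Suc (length us)" for i
    using that \<open>t = 0\<close> less_Suc_eq by (auto simp: t_def)
  then show "z = 0\<^sub>v (dim_col (mat_of_cols n (us @ [r])))"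
    using z by (intro eq_vecI) auto
qed

text \<open>One Arnoldi step as an operation on subspaces. No basis, coefficient or norm enters, so
  iterating it with \<open>^^\<close> depends only on the starting subspace.\<close>

definition krylov_step :: "complex mat \<Rightarrow> complex vec set \<Rightarrow> complex vec set" where
  "krylov_step A X = cspan (dim_row A) (X \<union> (*\<^sub>v) A ` X)"

lemma arnoldi_residual_carrier: "A \<in> carrier_mat n n \<Longrightarrow> arnoldi_residual cf A us \<in> carrier_vec n"
  unfolding arnoldi_residual_def by (rule carrier_vecI) simp

lemma length_arnoldi_basis [simp]: "length (arnoldi_basis cf nf A us k) = length us + k"
  by (induction k) (auto simp: Let_def)

lemma arnoldi_basis_carrier:
  assumes "A \<in> carrier_mat n n" "set us \<subseteq> carrier_vec n"
  shows "set (arnoldi_basis cf nf A us k) \<subseteq> carrier_vec n"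
  by (induction k) (use assms arnoldi_residual_carrier[OF assms(1)] in \<open>auto simp: Let_def\<close>)

lemma arnoldi_basis_mono:
  "j \<le> k \<Longrightarrow> set (arnoldi_basis cf nf A us j) \<subseteq> set (arnoldi_basis cf nf A us k)"
  by (rule lift_Suc_mono_le[of "\<lambda>k. set (arnoldi_basis cf nf A us k)"]) (auto simp: Let_def)

lemma set_arnoldi_residuals:
  "set (arnoldi_residuals cf nf A us s) =
     (\<lambda>k. arnoldi_residual cf A (arnoldi_basis cf nf A us k)) ` {..<s}"
  by (auto simp: arnoldi_residuals_def)

text \<open>By \<open>inv\<close>, only the image of the last vector can leave the current span, and
  the appended vector is a nonzero multiple of that image up to a vector of the span. The second
  conclusion is \<open>inv\<close> for the extended list, whose \<open>butlast\<close> is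
  \<open>us\<close>, so that the step can be repeated.\<close>

lemma krylov_step_cspan:
  assumes A: "A \<in> carrier_mat n n" and us: "set us \<subseteq> carrier_vec n" and ne: "us \<noteq> []"
    and inv: "\<And>u. u \<in> set (butlast us) \<Longrightarrow> A *\<^sub>v u \<in> cspan n (set us)"
    and h: "h \<in> carrier_vec (length us)" and s: "s \<noteq> 0"
    and r: "r = A *\<^sub>v last us - mat_of_cols n us *\<^sub>v h"
  shows "cspan n (set (us @ [s \<cdot>\<^sub>v r])) = krylov_step A (cspan n (set us))"
    and "\<And>u. u \<in> set us \<Longrightarrow> A *\<^sub>v u \<in> cspan n (set (us @ [s \<cdot>\<^sub>v r]))"
proof -
  let ?us = "us @ [s \<cdot>\<^sub>v r]" and ?X = "cspan n (set us)"
  let ?Y = "?X \<union> (*\<^sub>v) A ` ?X"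
  have X: "?X \<subseteq> carrier_vec n" using us by (rule cspan_carrier)
  have Y: "?Y \<subseteq> carrier_vec n" using X A by auto
  have last: "last us \<in> set us" using ne by simp
  have lc: "A *\<^sub>v last us \<in> carrier_vec n" using A us last by auto
  have Mh: "mat_of_cols n us *\<^sub>v h \<in> ?X" using us h by (rule mult_mat_of_cols_cspan)
  then have Mhc: "mat_of_cols n us *\<^sub>v h \<in> carrier_vec n" using X by blast
  have rc: "r \<in> carrier_vec n" unfolding r using lc Mhc by auto
  have us': "set ?us \<subseteq> carrier_vec n" using us rc by auto
  have sub: "?X \<subseteq> cspan n (set ?us)" by (rule cspan_mono) auto
  show im: "A *\<^sub>v u \<in> cspan n (set ?us)" if u: "u \<in> set us" for u
  proof (cases "u \<in> set (butlast us)")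
    case True
    then show ?thesis using inv sub by blast
  next
    case False
    then have u: "u = last us" using u ne
      by (metis append_butlast_last_id rotate1.simps(2) set_ConsD set_rotate1)
    \<comment> \<open>The definition of \<open>r\<close> is solved for the image of the last vector;
      as \<open>s\<close> is nonzero, \<open>r\<close> is recovered from the appended
      vector.\<close>
    have "A *\<^sub>v u = (1 / s) \<cdot>\<^sub>v (s \<cdot>\<^sub>v r) + mat_of_cols n us *\<^sub>v h"
      unfolding u r using A s lc Mhc by (intro eq_vecI) auto
    moreover have "s \<cdot>\<^sub>v r \<in> cspan n (set ?us)" using cspan_superset[OF us'] by auto
    ultimately show ?thesis
      using cspan_add[OF us' cspan_smult[OF us', of "s \<cdot>\<^sub>v r" "1 / s"]] Mh sub by auto
  qed
  have "A *\<^sub>v x \<in> cspan n (set ?us)" if "x \<in> ?X" for x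
    using mult_mat_vec_cspan[OF A us us' im that] .
  then have "krylov_step A ?X \<subseteq> cspan n (set ?us)"
    unfolding krylov_step_def carrier_matD(1)[OF A] using us' sub by (intro cspan_least) auto
  moreover have "cspan n (set ?us) \<subseteq> krylov_step A ?X"
  proof -
    have 1: "?Y \<subseteq> cspan n ?Y" using Y by (rule cspan_superset)
    have "last us \<in> ?X" using last cspan_superset[OF us] by blast
    then have "s \<cdot>\<^sub>v r \<in> cspan n ?Y"
      unfolding r using 1 Mh by (intro cspan_smult[OF Y] cspan_diff[OF Y]) auto
    moreover have "set us \<subseteq> cspan n ?Y" using cspan_superset[OF us] 1 by blast
    ultimately have "cspan n (set ?us) \<subseteq> cspan n ?Y" by (intro cspan_least[OF Y]) auto
    then show ?thesis using A by (simp add: krylov_step_def)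
  qed
  ultimately show "cspan n (set ?us) = krylov_step A ?X" by blast
qed

text \<open>The two processes differ only in how \<open>coeff\<close> and \<open>nf\<close> are
  established. A zero norm has to be excluded because \<open>1 / 0 = 0\<close> would append the zero
  vector and the span would stop growing.\<close>

lemma cspan_arnoldi_basis:
  assumes A: "A \<in> carrier_mat n n" and us: "set us \<subseteq> carrier_vec n" and ne: "us \<noteq> []"
    and inv: "\<And>u. u \<in> set (butlast us) \<Longrightarrow> A *\<^sub>v u \<in> cspan n (set us)"
    and coeff: "\<And>j. j < k \<Longrightarrow>
      arnoldi_coeff cf A (arnoldi_basis cf nf A us j) \<in> carrier_vec (length us + j)"
    and nf: "\<And>j. j < k \<Longrightarrow> nf (arnoldi_residual cf A (arnoldi_basis cf nf A us j)) \<noteq> 0"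
  shows "cspan n (set (arnoldi_basis cf nf A us k)) = (krylov_step A ^^ k) (cspan n (set us))"
proof -
  let ?B = "arnoldi_basis cf nf A us"
  \<comment> \<open>The claim is strengthened by the image condition on \<open>butlast\<close>,
    which each step consumes and restores.\<close>
  have "cspan n (set (?B k)) = (krylov_step A ^^ k) (cspan n (set us)) \<and>
    (\<forall>u \<in> set (butlast (?B k)). A *\<^sub>v u \<in> cspan n (set (?B k)))"
    using coeff nf
  proof (induction k)
    case 0
    then show ?case using inv by simp
  next
    case (Suc k)
    define vs where "vs = ?B k"
    define h where "h = arnoldi_coeff cf A vs"
    define r where "r = arnoldi_residual cf A vs"
    define s where "s = 1 / complex_of_real (nf r)"
    have IH: "cspan n (set vs) = (krylov_step A ^^ k) (cspan n (set us))"
      "\<And>u. u \<in> set (butlast vs) \<Longrightarrow> A *\<^sub>v u \<in> cspan n (set vs)"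
      using Suc unfolding vs_def by auto
    have vs: "set vs \<subseteq> carrier_vec n" unfolding vs_def by (rule arnoldi_basis_carrier[OF A us])
    have "length vs \<noteq> 0" using ne by (simp add: vs_def)
    then have vs_ne: "vs \<noteq> []" by auto
    have h: "h \<in> carrier_vec (length vs)" using Suc.prems by (simp add: h_def vs_def)
    have s: "s \<noteq> 0" using Suc.prems by (simp add: s_def r_def vs_def)
    have r: "r = A *\<^sub>v last vs - mat_of_cols n vs *\<^sub>v h"
      using A by (simp add: r_def h_def arnoldi_residual_def)
    have "?B (Suc k) = vs @ [s \<cdot>\<^sub>v r]" by (simp add: Let_def vs_def s_def r_def)
    then show ?case
      using krylov_step_cspan[OF A vs vs_ne IH(2) h s r] IH(1) by simp
  qed
  then show ?thesis ..
qed

section \<open>The sketched and the orthogonal process\<close>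

lemma cscalar_prod_self: "v \<bullet>c v = complex_of_real ((cvec_norm v)\<^sup>2)"
proof -
  have "0 \<le> (\<Sum>i<dim_vec v. (cmod (v $ i))\<^sup>2)" by (simp add: sum_nonneg)
  then have "(cvec_norm v)\<^sup>2 = (\<Sum>i<dim_vec v. (cmod (v $ i))\<^sup>2)"
    unfolding cvec_norm_def by simp
  then show ?thesis
    by (simp add: scalar_prod_def atLeast0LessThan flip: complex_norm_square)
qed

lemma cvec_norm_eq_0_iff: "cvec_norm v = 0 \<longleftrightarrow> v = 0\<^sub>v (dim_vec v)"
proof -
  have "cvec_norm v = 0 \<longleftrightarrow> v \<bullet>c v = 0" unfolding cscalar_prod_self by simp
  also have "\<dots> \<longleftrightarrow> v = 0\<^sub>v (dim_vec v)"
    by (rule conjugate_square_eq_0_vec) (auto intro: carrier_vecI)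
  finally show ?thesis .
qed

text \<open>The lower bound has the positive factor \<open>1 - \<epsilon>\<close>, so
  \<open>\<Omega>\<close> is injective on the embedded space.\<close>

lemma subspace_embedding_kernel:
  assumes "subspace_embedding \<epsilon> \<Omega> W" "\<epsilon> < 1" "w \<in> W" "\<Omega> *\<^sub>v w = 0\<^sub>v (dim_row \<Omega>)"
  shows "w = 0\<^sub>v (dim_vec w)"
proof -
  have "cvec_norm (\<Omega> *\<^sub>v w) = 0" using assms(4) by (simp add: cvec_norm_eq_0_iff)
  then have "(1 - \<epsilon>) * (cvec_norm w)\<^sup>2 \<le> 0"
    using assms(1,3) unfolding subspace_embedding_def by fastforce
  then have "(cvec_norm w)\<^sup>2 \<le> 0" using assms(2) by (simp add: mult_le_0_iff)
  then show ?thesis by (simp add: cvec_norm_eq_0_iff)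
qed

text \<open>The sketched residual is orthogonal to the range of the sketched basis. If
  \<open>r\<close> were in the span of \<open>us\<close>, its sketch would also lie in that range
  and would therefore vanish. This replaces Euclidean orthogonality, which the randomized basis does
  not have.\<close>

lemma sketch_step:
  assumes A: "A \<in> carrier_mat n n" and O: "\<Omega> \<in> carrier_mat d n"
    and us: "set us \<subseteq> carrier_vec n" and ne: "us \<noteq> []"
    and inj: "injective_mat (mat_of_cols n us)"
    and ker: "\<And>w. w \<in> cspan n (set us) \<Longrightarrow> \<Omega> *\<^sub>v w = 0\<^sub>v d \<Longrightarrow> w = 0\<^sub>v n"
  defines "r \<equiv> arnoldi_residual (sketch_coeff \<Omega>) A us"
  assumes r: "\<Omega> *\<^sub>v r \<noteq> 0\<^sub>v d"
  shows "arnoldi_coeff (sketch_coeff \<Omega>) A us \<in> carrier_vec (length us)"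
    and "r \<notin> cspan n (set us)"
proof -
  let ?M = "mat_of_cols n us"
  let ?N = "\<Omega> * ?M" and ?w = "A *\<^sub>v last us"
  let ?h = "arnoldi_coeff (sketch_coeff \<Omega>) A us"
  have M: "?M \<in> carrier_mat n (length us)" by simp
  have N: "?N \<in> carrier_mat d (length us)" using O M by (rule mult_carrier_mat)
  have "last us \<in> carrier_vec n" using us ne last_in_set by blast
  then have w: "?w \<in> carrier_vec n" using A by auto
  then have Ow: "\<Omega> *\<^sub>v ?w \<in> carrier_vec d" using O by auto
  \<comment> \<open>Sketching keeps the basis independent because \<open>\<Omega>\<close> has
    trivial kernel on its span. Only then do the size and projection properties of
    \<open>pinv\<close> apply.\<close>
  have N_inj: "injective_mat ?N" unfolding injective_mat_def
  proof (intro ballI impI)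
    fix x assume "x \<in> carrier_vec (dim_col ?N)" and 0: "?N *\<^sub>v x = 0\<^sub>v (dim_row ?N)"
    then have x: "x \<in> carrier_vec (length us)" by simp
    have "\<Omega> *\<^sub>v (?M *\<^sub>v x) = 0\<^sub>v d" using assoc_mult_mat_vec[OF O M x] 0 O by simp
    then have "?M *\<^sub>v x = 0\<^sub>v n" using ker mult_mat_of_cols_cspan[OF us x] by blast
    then show "x = 0\<^sub>v (dim_col ?N)" using inj x by (simp add: injective_mat_def)
  qed
  have h_eq: "?h = pinv ?N *\<^sub>v (\<Omega> *\<^sub>v ?w)"
    using A by (simp add: arnoldi_coeff_def sketch_coeff_def)
  have "pinv ?N \<in> carrier_mat (length us) d" using pinv_carrier[OF N_inj] O by simp
  then show h: "?h \<in> carrier_vec (length us)" unfolding h_eq using Ow by auto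
  have Mh: "?M *\<^sub>v ?h \<in> carrier_vec n" using M h by (rule mult_mat_vec_carrier)
  have "r = ?w - ?M *\<^sub>v ?h" unfolding r_def arnoldi_residual_def using A by simp
  then have "\<Omega> *\<^sub>v r = \<Omega> *\<^sub>v ?w - ?N *\<^sub>v ?h"
    using mult_minus_distrib_mat_vec[OF O w Mh] assoc_mult_mat_vec[OF O M h] by simp
  then have orth: "mat_adjoint ?N *\<^sub>v (\<Omega> *\<^sub>v r) = 0\<^sub>v (length us)"
    using adjoint_pinv_residual[OF N_inj, of "\<Omega> *\<^sub>v ?w"] Ow O h_eq by simp
  show "r \<notin> cspan n (set us)"
  proof
    assume "r \<in> cspan n (set us)"
    then obtain y where y: "y \<in> carrier_vec (length us)" "r = ?M *\<^sub>v y"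
      using cspan_elem[OF us] by blast
    then have "\<Omega> *\<^sub>v r = ?N *\<^sub>v y" using assoc_mult_mat_vec[OF O M y(1)] by simp
    then have "\<Omega> *\<^sub>v r = 0\<^sub>v d"
      using orth y O mult_mat_vec_eq_0_if_adjoint[of y ?N] by simp
    then show False using r by simp
  qed
qed

text \<open>Independence of the current basis puts the residual outside its span, and this gives
  independence of the next basis. The hypothesis \<open>ker\<close> concerns the final span, which
  contains all earlier ones.\<close>

lemma sketch_arnoldi:
  assumes A: "A \<in> carrier_mat n n" and O: "\<Omega> \<in> carrier_mat d n"
    and us: "set us \<subseteq> carrier_vec n" and ne: "us \<noteq> []"
    and inj: "injective_mat (mat_of_cols n us)"
  defines "B \<equiv> arnoldi_basis (sketch_coeff \<Omega>) (sketch_norm \<Omega>) A us"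
    and "R \<equiv> arnoldi_residuals (sketch_coeff \<Omega>) (sketch_norm \<Omega>) A us"
  assumes ker: "\<And>w. w \<in> cspan n (set (B s) \<union> set (R s)) \<Longrightarrow> \<Omega> *\<^sub>v w = 0\<^sub>v d \<Longrightarrow> w = 0\<^sub>v n"
    and R: "0\<^sub>v n \<notin> set (R s)"
  shows "k \<le> s \<Longrightarrow> injective_mat (mat_of_cols n (B k))"
    and "k < s \<Longrightarrow> arnoldi_coeff (sketch_coeff \<Omega>) A (B k) \<in> carrier_vec (length us + k)"
    and "k < s \<Longrightarrow> sketch_norm \<Omega> (arnoldi_residual (sketch_coeff \<Omega>) A (B k)) \<noteq> 0"
proof -
  let ?r = "\<lambda>k. arnoldi_residual (sketch_coeff \<Omega>) A (B k)"
  have B: "set (B k) \<subseteq> carrier_vec n" for k unfolding B_def by (rule arnoldi_basis_carrier[OF A us])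
  have len: "length (B k) = length us + k" for k by (simp add: B_def)
  then have Bne: "B k \<noteq> []" for k using ne by (metis add_is_0 length_0_conv)
  have rc: "?r k \<in> carrier_vec n" for k by (rule arnoldi_residual_carrier[OF A])
  have Rs: "set (R s) = ?r ` {..<s}"
    by (simp add: R_def set_arnoldi_residuals B_def)
  \<comment> \<open>Residuals lie in the space on which \<open>\<Omega>\<close> is injective, so a
    nonzero residual has a nonzero sketch. This needs no induction.\<close>
  have r: "\<Omega> *\<^sub>v ?r k \<noteq> 0\<^sub>v d" if "k < s" for k
  proof
    assume 0: "\<Omega> *\<^sub>v ?r k = 0\<^sub>v d"
    have "?r k \<in> set (R s)" using that by (simp add: Rs)
    moreover have "set (B s) \<union> set (R s) \<subseteq> carrier_vec n" using B rc Rs by auto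
    ultimately have "?r k = 0\<^sub>v n" using ker[OF _ 0] cspan_superset by blast
    then show False using R \<open>?r k \<in> set (R s)\<close> by simp
  qed
  then show norm: "sketch_norm \<Omega> (?r k) \<noteq> 0" if "k < s" for k
    using that O by (simp add: sketch_norm_def cvec_norm_eq_0_iff)
  have kerB: "w = 0\<^sub>v n" if "k \<le> s" "w \<in> cspan n (set (B k))" "\<Omega> *\<^sub>v w = 0\<^sub>v d" for k w
  proof (rule ker[OF _ that(3)])
    have "set (B k) \<subseteq> set (B s) \<union> set (R s)"
      using arnoldi_basis_mono[OF that(1)] unfolding B_def by blast
    then show "w \<in> cspan n (set (B s) \<union> set (R s))" using that(2) cspan_mono by blast
  qed
  show inj: "injective_mat (mat_of_cols n (B k))" if "k \<le> s" for k
    using that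
  proof (induction k)
    case 0
    then show ?case using inj by (simp add: B_def)
  next
    case (Suc k)
    define t where "t = 1 / complex_of_real (sketch_norm \<Omega> (?r k))"
    have k: "k < s" using Suc.prems by simp
    have t: "t \<noteq> 0" using norm[OF k] by (simp add: t_def)
    have inj_k: "injective_mat (mat_of_cols n (B k))" using Suc by simp
    have "?r k \<notin> cspan n (set (B k))"
      by (rule sketch_step(2)[OF A O B Bne inj_k kerB[OF less_imp_le[OF k]] r[OF k]])
    \<comment> \<open>Undoing the scaling: if the normalized vector were in the span, so would be
      the residual.\<close>
    moreover have "(1 / t) \<cdot>\<^sub>v (t \<cdot>\<^sub>v ?r k) = ?r k" using t by (simp add: smult_smult_assoc)
    ultimately have "t \<cdot>\<^sub>v ?r k \<notin> cspan n (set (B k))"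
      using cspan_smult[OF B, of "t \<cdot>\<^sub>v ?r k" k "1 / t"] by auto
    then have "injective_mat (mat_of_cols n (B k @ [t \<cdot>\<^sub>v ?r k]))"
      using rc inj_k by (intro injective_mat_snoc[OF B]) auto
    then show ?case by (simp add: B_def t_def Let_def)
  qed
  show "arnoldi_coeff (sketch_coeff \<Omega>) A (B k) \<in> carrier_vec (length us + k)" if "k < s" for k
    using sketch_step(1)[OF A O B Bne inj[OF less_imp_le[OF that]] kerB[OF less_imp_le[OF that]] r[OF that]]
    by (simp only: len)
qed

lemma orthonormal_cols_iff:
  "orthonormal_cols M \<longleftrightarrow> (\<forall>i < dim_col M. \<forall>j < dim_col M. col M j \<bullet>c col M i = (if i = j then 1 else 0))"
proof -
  have "(mat_adjoint M * M) $$ (i, j) = col M j \<bullet>c col M i" if "i < dim_col M" "j < dim_col M" for i j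
    using that by (auto simp: scalar_prod_def mult.commute intro!: sum.cong)
  then show ?thesis unfolding orthonormal_cols_def mat_eq_iff by auto
qed

lemma mat_adjoint_mult_vec_eq_0_iff:
  assumes "q \<in> carrier_vec (dim_row M)"
  shows "mat_adjoint M *\<^sub>v q = 0\<^sub>v (dim_col M) \<longleftrightarrow> (\<forall>i < dim_col M. q \<bullet>c col M i = 0)"
proof -
  have "(mat_adjoint M *\<^sub>v q) $ i = q \<bullet>c col M i" if "i < dim_col M" for i
    using that assms by (auto simp: scalar_prod_def mult.commute intro!: sum.cong)
  then show ?thesis unfolding vec_eq_iff by auto
qed

lemma cscalar_prod_commute_0:
  fixes x y :: "complex vec"
  assumes "x \<in> carrier_vec n" "y \<in> carrier_vec n" "x \<bullet>c y = 0"
  shows "y \<bullet>c x = 0"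
proof -
  have "y \<bullet>c x = conjugate (x \<bullet>c y)"
    using assms(1,2) by (simp add: scalar_prod_def mult.commute)
  then show ?thesis using assms(3) by simp
qed

lemma orthonormal_cols_snoc:
  assumes us: "set us \<subseteq> carrier_vec n" and q: "q \<in> carrier_vec n"
    and orth: "orthonormal_cols (mat_of_cols n us)"
    and 0: "mat_adjoint (mat_of_cols n us) *\<^sub>v q = 0\<^sub>v (length us)" and 1: "q \<bullet>c q = 1"
  shows "orthonormal_cols (mat_of_cols n (us @ [q]))"
proof -
  have c: "us ! i \<in> carrier_vec n" if "i < length us" for i using us that nth_mem by blast
  have "q \<bullet>c (us ! i) = 0" if "i < length us" for i
    using 0 that q c[OF that] mat_adjoint_mult_vec_eq_0_iff[of q "mat_of_cols n us"]
    by (auto simp: col_mat_of_cols)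
  moreover from this have "(us ! i) \<bullet>c q = 0" if "i < length us" for i
    using cscalar_prod_commute_0[OF q c] that by simp
  moreover have "us ! j \<bullet>c us ! i = (if i = j then 1 else 0)" if "i < length us" "j < length us" for i j
    using orth that c unfolding orthonormal_cols_iff by (auto simp: col_mat_of_cols)
  moreover have "col (mat_of_cols n (us @ [q])) i = (if i < length us then us ! i else q)"
    if "i < Suc (length us)" for i
    using that c q by (subst col_mat_of_cols) (auto simp: nth_append less_Suc_eq)
  ultimately show ?thesis unfolding orthonormal_cols_iff
    using 1 by (auto simp: less_Suc_eq)
qed

lemma cscalar_prod_normalized:
  assumes "r \<noteq> 0\<^sub>v (dim_vec r)"
  defines "q \<equiv> (1 / complex_of_real (cvec_norm r)) \<cdot>\<^sub>v r"
  shows "q \<bullet>c q = 1"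
proof -
  have nz: "cvec_norm r \<noteq> 0" using assms by (simp add: cvec_norm_eq_0_iff)
  have "q \<bullet>c q = (1 / complex_of_real (cvec_norm r)) ^ 2 * (r \<bullet>c r)"
    by (simp add: q_def scalar_prod_def sum_distrib_left power2_eq_square mult_ac)
  then show ?thesis using nz unfolding cscalar_prod_self by (simp add: power_divide)
qed

text \<open>Orthonormality turns the Gram matrix into the identity, so the adjoint of the basis
  cancels the subtracted projection against the image itself.\<close>

lemma gs_step:
  assumes A: "A \<in> carrier_mat n n" and us: "set us \<subseteq> carrier_vec n" and ne: "us \<noteq> []"
    and orth: "orthonormal_cols (mat_of_cols n us)"
  defines "r \<equiv> arnoldi_residual gs_coeff A us"
  shows "mat_adjoint (mat_of_cols n us) *\<^sub>v r = 0\<^sub>v (length us)"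
proof -
  let ?M = "mat_of_cols n us" and ?w = "A *\<^sub>v last us"
  have M: "?M \<in> carrier_mat n (length us)" by simp
  have M': "mat_adjoint ?M \<in> carrier_mat (length us) n" using mat_adjoint_carrier[of ?M] by simp
  have "last us \<in> carrier_vec n" using us ne last_in_set by blast
  then have w: "?w \<in> carrier_vec n" using A by auto
  have h: "mat_adjoint ?M *\<^sub>v ?w \<in> carrier_vec (length us)" using M' w by (rule mult_mat_vec_carrier)
  have "r = ?w - ?M *\<^sub>v (mat_adjoint ?M *\<^sub>v ?w)"
    using A by (simp add: r_def arnoldi_residual_def arnoldi_coeff_def gs_coeff_def)
  then have "mat_adjoint ?M *\<^sub>v r = mat_adjoint ?M *\<^sub>v ?w - (mat_adjoint ?M * ?M) *\<^sub>v (mat_adjoint ?M *\<^sub>v ?w)"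
    using mult_minus_distrib_mat_vec[OF M' w mult_mat_vec_carrier[OF M h]]
      assoc_mult_mat_vec[OF M' M h] by simp
  then show ?thesis using orth h by (simp add: orthonormal_cols_def)
qed

lemma gs_arnoldi_orthonormal:
  assumes A: "A \<in> carrier_mat n n" and us: "set us \<subseteq> carrier_vec n" and ne: "us \<noteq> []"
    and orth: "orthonormal_cols (mat_of_cols n us)"
  defines "B \<equiv> arnoldi_basis gs_coeff cvec_norm A us"
  assumes nz: "0\<^sub>v n \<notin> set (arnoldi_residuals gs_coeff cvec_norm A us s)"
  shows "k \<le> s \<Longrightarrow> orthonormal_cols (mat_of_cols n (B k))"
proof (induction k)
  case 0
  then show ?case using orth by (simp add: B_def)
next
  case (Suc k)
  let ?r = "arnoldi_residual gs_coeff A (B k)"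
  have B: "set (B k) \<subseteq> carrier_vec n" unfolding B_def by (rule arnoldi_basis_carrier[OF A us])
  have "length (B k) \<noteq> 0" using ne by (simp add: B_def)
  then have Bne: "B k \<noteq> []" by auto
  have rc: "?r \<in> carrier_vec n" by (rule arnoldi_residual_carrier[OF A])
  let ?q = "(1 / complex_of_real (cvec_norm ?r)) \<cdot>\<^sub>v ?r"
  have "?r \<in> set (arnoldi_residuals gs_coeff cvec_norm A us s)"
    unfolding set_arnoldi_residuals B_def using Suc.prems by (intro imageI) simp
  then have "?r \<noteq> 0\<^sub>v n" using nz by metis
  then have "?q \<bullet>c ?q = 1" using rc by (intro cscalar_prod_normalized) auto
  moreover have "mat_adjoint (mat_of_cols n (B k)) *\<^sub>v ?q = 0\<^sub>v (length (B k))"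
    using gs_step[OF A B Bne] Suc rc mult_mat_vec[of "mat_adjoint (mat_of_cols n (B k))" "length (B k)" n ?r]
      mat_adjoint_carrier[of "mat_of_cols n (B k)"]
    by (simp add: vec_eq_iff)
  ultimately have "orthonormal_cols (mat_of_cols n (B k @ [?q]))"
    using Suc rc B by (intro orthonormal_cols_snoc) auto
  then show ?case by (simp add: B_def Let_def)
qed

section \<open>Schur decompositions and invariant subspaces\<close>

lemma mult_mat_zero_vec: "M \<in> carrier_mat m k \<Longrightarrow> M *\<^sub>v 0\<^sub>v k = 0\<^sub>v m"
  by (intro eq_vecI) auto

lemma zero_mat_mult_vec: "x \<in> carrier_vec l \<Longrightarrow> 0\<^sub>m k l *\<^sub>v x = 0\<^sub>v k"
  by (intro eq_vecI) auto

lemma hcat_carrier: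
  assumes "V \<in> carrier_mat m l" "V' \<in> carrier_mat m k"
  shows "hcat V V' \<in> carrier_mat m (l + k)"
  using assms unfolding hcat_def by (intro carrier_matI) auto

lemma col_hcat:
  assumes V: "V \<in> carrier_mat m l" "V' \<in> carrier_mat m k" and j: "j < l + k"
  shows "col (hcat V V') j = (if j < l then col V j else col V' (j - l))"
  unfolding hcat_def using assms by (subst col_mat_of_cols) (auto simp: nth_append)

lemma hcat_mult_append:
  assumes V: "V \<in> carrier_mat m l" "V' \<in> carrier_mat m k"
    and ab: "a \<in> carrier_vec l" "b \<in> carrier_vec k"
  shows "hcat V V' *\<^sub>v (a @\<^sub>v b) = V *\<^sub>v a + V' *\<^sub>v b"
proof (rule eq_vecI)
  note P = hcat_carrier[OF V]
  fix i assume "i < dim_vec (V *\<^sub>v a + V' *\<^sub>v b)"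
  then have i: "i < m" using V by simp
  have "row (hcat V V') i = row V i @\<^sub>v row V' i"
  proof (rule eq_vecI)
    fix j assume "j < dim_vec (row V i @\<^sub>v row V' i)"
    then have j: "j < l + k" using V by simp
    have "row (hcat V V') i $ j = col (hcat V V') j $ i" using i j P by simp
    then show "row (hcat V V') i $ j = (row V i @\<^sub>v row V' i) $ j"
      unfolding col_hcat[OF V j] using i j V by (auto split: if_splits)
  qed (use V P in simp)
  moreover have "(row V i @\<^sub>v row V' i) \<bullet> (a @\<^sub>v b) = row V i \<bullet> a + row V' i \<bullet> b"
    using V i ab by (intro scalar_prod_append[of _ l _ k]) auto
  ultimately show "(hcat V V' *\<^sub>v (a @\<^sub>v b)) $ i = (V *\<^sub>v a + V' *\<^sub>v b) $ i"
    using P V i by simp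
qed (use hcat_carrier[OF V] V in simp)

lemma mat_adjoint_mult_vec_index:
  assumes "q \<in> carrier_vec (dim_row M)" "i < dim_col M"
  shows "(mat_adjoint M *\<^sub>v q) $ i = q \<bullet>c col M i"
  using assms by (auto simp: scalar_prod_def mult.commute intro!: sum.cong)

lemma adjoint_hcat_mult:
  assumes V: "V \<in> carrier_mat m l" "V' \<in> carrier_mat m k" and w: "w \<in> carrier_vec m"
  shows "mat_adjoint (hcat V V') *\<^sub>v w = (mat_adjoint V *\<^sub>v w) @\<^sub>v (mat_adjoint V' *\<^sub>v w)"
proof (rule eq_vecI)
  note P = hcat_carrier[OF V]
  fix i assume "i < dim_vec ((mat_adjoint V *\<^sub>v w) @\<^sub>v (mat_adjoint V' *\<^sub>v w))"
  then have i: "i < l + k" using V by simp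
  have "(mat_adjoint (hcat V V') *\<^sub>v w) $ i = w \<bullet>c col (hcat V V') i"
    using i w P by (intro mat_adjoint_mult_vec_index) auto
  moreover have "(mat_adjoint V *\<^sub>v w) $ i = w \<bullet>c col V i" if "i < l"
    using that w V by (intro mat_adjoint_mult_vec_index) auto
  moreover have "(mat_adjoint V' *\<^sub>v w) $ (i - l) = w \<bullet>c col V' (i - l)" if "\<not> i < l"
    using that i w V by (intro mat_adjoint_mult_vec_index) auto
  ultimately show "(mat_adjoint (hcat V V') *\<^sub>v w) $ i =
      ((mat_adjoint V *\<^sub>v w) @\<^sub>v (mat_adjoint V' *\<^sub>v w)) $ i"
    unfolding col_hcat[OF V i] using V i by simp
qed (use hcat_carrier[OF V] V in simp)

text \<open>All four facts are read off in the coordinates given by the unitary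
  \<open>P = [V, V']\<close>, in which \<open>H\<close> becomes block triangular. The second says
  that the range of \<open>V\<close> is invariant; the third is its dual, that the adjoint of
  \<open>V'\<close> carries \<open>H\<close> to \<open>S'\<close>. Both rest on the zero block of
  \<open>T\<close>.\<close>

lemma ordered_schur_invariance:
  assumes schur: "ordered_schur H m l V V' S Sx S'" and H: "H \<in> carrier_mat m m" and l: "l \<le> m"
  shows "\<And>x. x \<in> carrier_vec l \<Longrightarrow> V *\<^sub>v x = 0\<^sub>v m \<Longrightarrow> x = 0\<^sub>v l"
    and "\<And>x. x \<in> carrier_vec l \<Longrightarrow> H *\<^sub>v (V *\<^sub>v x) = V *\<^sub>v (S *\<^sub>v x)"
    and "\<And>w. w \<in> carrier_vec m \<Longrightarrow>
      mat_adjoint V' *\<^sub>v (H *\<^sub>v w) = S' *\<^sub>v (mat_adjoint V' *\<^sub>v w)"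
    and "\<And>w. w \<in> carrier_vec m \<Longrightarrow> mat_adjoint V' *\<^sub>v w = 0\<^sub>v (m - l) \<Longrightarrow>
      w = V *\<^sub>v (mat_adjoint V *\<^sub>v w)"
proof -
  define k where "k = m - l"
  have m: "m = l + k" using l by (simp add: k_def)
  define P where "P = hcat V V'"
  define T where "T = four_block_mat S Sx (0\<^sub>m k l) S'"
  have V: "V \<in> carrier_mat m l" "V' \<in> carrier_mat m k"
    and S: "S \<in> carrier_mat l l" "Sx \<in> carrier_mat l k" "S' \<in> carrier_mat k k"
    and uni: "unitary_mat P" and HP: "H * P = P * T"
    using schur unfolding ordered_schur_def P_def T_def k_def by auto
  have P: "P \<in> carrier_mat m m" using hcat_carrier[OF V] by (simp add: P_def m)
  have T: "T \<in> carrier_mat m m" unfolding T_def m using S(1,3) by (rule four_block_carrier_mat)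
  have P': "mat_adjoint P \<in> carrier_mat m m" using mat_adjoint_carrier[of P] P by auto
  have P'P: "mat_adjoint P * P = 1\<^sub>m m"
    using uni P by (simp add: unitary_mat_def orthonormal_cols_def)
  have PP': "P * mat_adjoint P = 1\<^sub>m m" by (rule mat_mult_left_right_inverse[OF P' P P'P])
  have T_app: "T *\<^sub>v (a @\<^sub>v b) = (S *\<^sub>v a + Sx *\<^sub>v b) @\<^sub>v (0\<^sub>m k l *\<^sub>v a + S' *\<^sub>v b)"
    if "a \<in> carrier_vec l" "b \<in> carrier_vec k" for a b
    unfolding T_def using S that by (intro four_block_mat_mult_vec) auto
  have PV: "P *\<^sub>v (x @\<^sub>v 0\<^sub>v k) = V *\<^sub>v x" if "x \<in> carrier_vec l" for x
    unfolding P_def using hcat_mult_append[OF V that, of "0\<^sub>v k"] mult_mat_zero_vec[OF V(2)] V that by simp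
  have x0: "x @\<^sub>v 0\<^sub>v k \<in> carrier_vec m" if "x \<in> carrier_vec l" for x :: "complex vec"
    using that m by simp
  show "x = 0\<^sub>v l" if x: "x \<in> carrier_vec l" and 0: "V *\<^sub>v x = 0\<^sub>v m" for x
  proof -
    have "injective_mat P" using uni by (intro orthonormal_cols_injective) (simp add: unitary_mat_def)
    then have "x @\<^sub>v 0\<^sub>v k = 0\<^sub>v m"
      using PV[OF x] x0[OF x] 0 P by (simp add: injective_mat_def)
    also have "\<dots> = 0\<^sub>v l @\<^sub>v 0\<^sub>v k" unfolding m by (intro eq_vecI) auto
    finally show ?thesis using x append_vec_eq[of x l "0\<^sub>v l"] by simp
  qed
  show "H *\<^sub>v (V *\<^sub>v x) = V *\<^sub>v (S *\<^sub>v x)" if x: "x \<in> carrier_vec l" for x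
  proof -
    have Sx: "S *\<^sub>v x \<in> carrier_vec l" using S(1) x by (rule mult_mat_vec_carrier)
    have "H *\<^sub>v (V *\<^sub>v x) = H * P *\<^sub>v (x @\<^sub>v 0\<^sub>v k)"
      using assoc_mult_mat_vec[OF H P x0[OF x]] PV[OF x] by simp
    also have "\<dots> = P *\<^sub>v (T *\<^sub>v (x @\<^sub>v 0\<^sub>v k))"
      unfolding HP by (rule assoc_mult_mat_vec[OF P T x0[OF x]])
    also have "T *\<^sub>v (x @\<^sub>v 0\<^sub>v k) = (S *\<^sub>v x) @\<^sub>v 0\<^sub>v k"
      using T_app[OF x, of "0\<^sub>v k"] mult_mat_zero_vec[OF S(2)] mult_mat_zero_vec[OF S(3)]
        zero_mat_mult_vec[OF x] Sx by simp
    finally show ?thesis using PV[OF Sx] by simp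
  qed
  have V'c: "mat_adjoint V \<in> carrier_mat l m" "mat_adjoint V' \<in> carrier_mat k m"
    using V mat_adjoint_carrier[of V] mat_adjoint_carrier[of V'] by auto
  have P'_app: "mat_adjoint P *\<^sub>v w = (mat_adjoint V *\<^sub>v w) @\<^sub>v (mat_adjoint V' *\<^sub>v w)"
    if "w \<in> carrier_vec m" for w
    unfolding P_def using V that by (rule adjoint_hcat_mult)
  have PP'_app: "P *\<^sub>v (mat_adjoint P *\<^sub>v w) = w" if "w \<in> carrier_vec m" for w
    using assoc_mult_mat_vec[OF P P' that] PP' that by simp
  show "mat_adjoint V' *\<^sub>v (H *\<^sub>v w) = S' *\<^sub>v (mat_adjoint V' *\<^sub>v w)" if w: "w \<in> carrier_vec m" for w
  proof -
    let ?p = "mat_adjoint P *\<^sub>v w"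
    have p: "?p \<in> carrier_vec m" using P' w by (rule mult_mat_vec_carrier)
    have Tp: "T *\<^sub>v ?p \<in> carrier_vec m" using T p by (rule mult_mat_vec_carrier)
    have Hw: "H *\<^sub>v w \<in> carrier_vec m" using H w by (rule mult_mat_vec_carrier)
    have "H *\<^sub>v w = H * P *\<^sub>v ?p" using assoc_mult_mat_vec[OF H P p] PP'_app[OF w] by simp
    also have "\<dots> = P *\<^sub>v (T *\<^sub>v ?p)" unfolding HP by (rule assoc_mult_mat_vec[OF P T p])
    finally have "mat_adjoint P *\<^sub>v (H *\<^sub>v w) = T *\<^sub>v ?p"
      using assoc_mult_mat_vec[OF P' P Tp] P'P Tp by simp
    moreover have c: "mat_adjoint V *\<^sub>v w \<in> carrier_vec l" "mat_adjoint V' *\<^sub>v w \<in> carrier_vec k"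
      "mat_adjoint V *\<^sub>v (H *\<^sub>v w) \<in> carrier_vec l"
      using V'c w Hw by auto
    moreover have "S *\<^sub>v (mat_adjoint V *\<^sub>v w) + Sx *\<^sub>v (mat_adjoint V' *\<^sub>v w) \<in> carrier_vec l"
      using S c by auto
    \<comment> \<open>This is the lower block of the preceding equation between appended
      vectors.\<close>
    ultimately have "mat_adjoint V' *\<^sub>v (H *\<^sub>v w) = 0\<^sub>m k l *\<^sub>v (mat_adjoint V *\<^sub>v w) + S' *\<^sub>v (mat_adjoint V' *\<^sub>v w)"
      unfolding P'_app[OF w] P'_app[OF Hw] T_app[OF c(1,2)] by simp
    then show ?thesis using S c zero_mat_mult_vec[OF c(1)] by simp
  qed
  show "w = V *\<^sub>v (mat_adjoint V *\<^sub>v w)"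
    if w: "w \<in> carrier_vec m" and 0: "mat_adjoint V' *\<^sub>v w = 0\<^sub>v (m - l)" for w
  proof -
    have c: "mat_adjoint V *\<^sub>v w \<in> carrier_vec l" using V'c(1) w by (rule mult_mat_vec_carrier)
    show ?thesis using PP'_app[OF w] PV[OF c] 0 unfolding P'_app[OF w] by (simp add: k_def)
  qed
qed

text \<open>Forward substitution over the columns of \<open>Z\<close>: once the earlier columns
  vanish, column \<open>j\<close> satisfies the eigenvector equation of \<open>S'\<close> for
  \<open>R $$ (j, j)\<close>, which is not an eigenvalue, so it is 0 as well.\<close>

lemma sylvester_upper_triangular:
  fixes S' R Z :: "complex mat"
  assumes S': "S' \<in> carrier_mat k k" and R: "R \<in> carrier_mat l l" and Z: "Z \<in> carrier_mat k l"
    and ut: "upper_triangular R" and eq: "S' * Z = Z * R"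
    and ev: "\<And>j. j < l \<Longrightarrow> \<not> eigenvalue S' (R $$ (j, j))"
  shows "Z = 0\<^sub>m k l"
proof -
  have "col Z j = 0\<^sub>v k" if "j < l" for j
    using that
  proof (induction j rule: less_induct)
    case (less j)
    have Zc: "col Z j \<in> carrier_vec k" using Z by (auto intro: carrier_vecI)
    have Z0: "Z $$ (r, i) = 0" if "r < k" "i < j" for r i
    proof -
      have "col Z i = 0\<^sub>v k" using less that by simp
      then have "col Z i $ r = 0" using that by simp
      then show ?thesis using that less.prems Z by simp
    qed
    have "S' *\<^sub>v col Z j = col (Z * R) j"
      using col_mult2[OF S' Z less.prems] eq by simp
    also have "\<dots> = R $$ (j, j) \<cdot>\<^sub>v col Z j"
    proof (rule eq_vecI)
      fix r assume "r < dim_vec (R $$ (j, j) \<cdot>\<^sub>v col Z j)"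
      then have r: "r < k" using Z by simp
      have "col (Z * R) j $ r = (\<Sum>i = 0..<l. Z $$ (r, i) * R $$ (i, j))"
        using r less.prems Z R by (simp add: scalar_prod_def)
      \<comment> \<open>Terms with \<open>i < j\<close> vanish by the induction hypothesis, those
        with \<open>i > j\<close> by triangularity of \<open>R\<close>.\<close>
      also have "\<dots> = (\<Sum>i = 0..<l. if i = j then Z $$ (r, j) * R $$ (j, j) else 0)"
      proof (rule sum.cong)
        fix i assume "i \<in> {0..<l}"
        then show "Z $$ (r, i) * R $$ (i, j) = (if i = j then Z $$ (r, j) * R $$ (j, j) else 0)"
          using Z0[OF r, of i] ut R less.prems unfolding upper_triangular_def
          by (cases i j rule: linorder_cases) auto
      qed simp
      also have "\<dots> = (R $$ (j, j) \<cdot>\<^sub>v col Z j) $ r"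
        using r less.prems Z by simp
      finally show "col (Z * R) j $ r = (R $$ (j, j) \<cdot>\<^sub>v col Z j) $ r" .
    qed (use Z in simp)
    finally have "S' *\<^sub>v col Z j = R $$ (j, j) \<cdot>\<^sub>v col Z j" .
    then show ?case
      using ev[OF less.prems] S' Zc unfolding eigenvalue_def eigenvector_def by auto
  qed
  then have "Z $$ (r, j) = 0" if "r < k" "j < l" for r j
    using that Z by (metis carrier_matD index_col index_zero_vec(1))
  then show ?thesis using Z by (intro eq_matI) auto
qed

text \<open>Membership in \<open>proots\<close> means being a root only for a nonzero polynomial;
  the characteristic polynomial is monic.\<close>

lemma eigenvalue_iff_eigvals:
  assumes M: "M \<in> carrier_mat n n"
  shows "eigenvalue M x \<longleftrightarrow> x \<in># eigvals M"
proof -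
  have "char_poly M \<noteq> 0" using degree_monic_char_poly[OF M] by auto
  then show ?thesis unfolding eigenvalue_root_char_poly[OF M] eigvals_def by simp
qed

lemma eigenvalue_upper_triangular_diag:
  fixes R :: "complex mat"
  assumes R: "R \<in> carrier_mat l l" and ut: "upper_triangular R" and j: "j < l"
  shows "eigenvalue R (R $$ (j, j))"
proof -
  have "R $$ (j, j) \<in> set (diag_mat R)" using R j by (auto simp: diag_mat_def)
  then show ?thesis
    unfolding eigenvalue_root_char_poly[OF R] char_poly_upper_triangular[OF R ut]
    by (auto simp: poly_prod_list prod_list_zero_iff)
qed

lemma outer_prod_mult_vec:
  assumes u: "u \<in> carrier_vec n" and c: "c \<in> carrier_vec m" and x: "x \<in> carrier_vec m"
  shows "outer_prod u c *\<^sub>v x = (x \<bullet>c c) \<cdot>\<^sub>v u"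
proof -
  let ?u = "mat_of_cols n [u]" and ?c = "mat_of_cols m [c]"
  have cc: "mat_adjoint ?c \<in> carrier_mat 1 m" using mat_adjoint_carrier[of ?c] by simp
  have uc: "?u \<in> carrier_mat n 1" using mat_of_cols_carrier(1)[of n "[u]"] by simp
  have "outer_prod u c *\<^sub>v x = ?u *\<^sub>v (mat_adjoint ?c *\<^sub>v x)"
    unfolding outer_prod_def using assoc_mult_mat_vec[OF uc cc x] u c by simp
  also have "\<dots> = (x \<bullet>c c) \<cdot>\<^sub>v u"
  proof (rule eq_vecI)
    fix i assume "i < dim_vec ((x \<bullet>c c) \<cdot>\<^sub>v u)"
    then have i: "i < n" using u by simp
    have "(mat_adjoint ?c *\<^sub>v x) $ 0 = x \<bullet>c col ?c 0"
      using x by (intro mat_adjoint_mult_vec_index) auto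
    also have "col ?c 0 = c" using c by (subst col_mat_of_cols) auto
    finally show "(?u *\<^sub>v (mat_adjoint ?c *\<^sub>v x)) $ i = ((x \<bullet>c c) \<cdot>\<^sub>v u) $ i"
      using i u by (simp add: scalar_prod_def mat_of_cols_index)
  qed (use u in simp)
  finally show ?thesis .
qed

lemma mult_mat_unit_vec:
  "M \<in> carrier_mat k l \<Longrightarrow> j < l \<Longrightarrow> M *\<^sub>v unit_vec l j = col M j"
  for M :: "complex mat"
  by (intro eq_vecI) auto

text \<open>The partial Schur basis \<open>Vt\<close> is rewritten as \<open>W\<close> in the
  coordinates of \<open>U\<close>, where \<open>H\<close> can be compared with its own Schur
  decomposition. Disjoint spectra force \<open>W\<close> into the range of \<open>V\<close>, and the
  equal number of columns gives equality.\<close>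

lemma compressed_range_eq:
  fixes A U H Q V V' S Sx S' Vt St :: "complex mat" and u c :: "complex vec"
  assumes A: "A \<in> carrier_mat n n" and krylov: "krylov_decomp A n m U H u c"
    and orth: "mat_adjoint U *\<^sub>v u = 0\<^sub>v m" and inj: "injective_mat U"
    and schur: "ordered_schur H m l V V' S Sx S'" and l: "l \<le> m"
    and disj: "spectrum S \<inter> spectrum S' = {}"
    and Q: "Q \<in> carrier_mat n m" and Q_orth: "orthonormal_cols Q" and ran: "range_mat Q = range_mat U"
    and partial: "partial_schur (mat_adjoint Q * A * Q) m l Vt St"
    and ev: "eigvals S = eigvals St"
  shows "range_mat (U * V) = range_mat (Q * Vt)"
proof -
  have U: "U \<in> carrier_mat n m" and H: "H \<in> carrier_mat m m" and u: "u \<in> carrier_vec n"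
    and c: "c \<in> carrier_vec m" and AU: "A * U = U * H + outer_prod u c"
    using krylov unfolding krylov_decomp_def by auto
  have V: "V \<in> carrier_mat m l" and V': "V' \<in> carrier_mat m (m - l)"
    and S: "S \<in> carrier_mat l l" and S': "S' \<in> carrier_mat (m - l) (m - l)"
    using schur unfolding ordered_schur_def by auto
  have Vt: "Vt \<in> carrier_mat m l" and St: "St \<in> carrier_mat l l" and Vt_orth: "orthonormal_cols Vt"
    and ut: "upper_triangular St" and GVt: "mat_adjoint Q * A * Q * Vt = Vt * St"
    using partial unfolding partial_schur_def by auto
  note inv = ordered_schur_invariance[OF schur H l]
  let ?Q' = "mat_adjoint Q"
  have Q': "?Q' \<in> carrier_mat m n" using mat_adjoint_carrier[of Q] Q by auto
  have Q'Q: "?Q' *\<^sub>v (Q *\<^sub>v z) = z" if "z \<in> carrier_vec m" for z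
    using assoc_mult_mat_vec[OF Q' Q that] Q_orth Q that by (simp add: orthonormal_cols_def)
  \<comment> \<open>The projector onto the range of \<open>Q\<close> acts as the identity on the
    range of \<open>U\<close>, the two ranges being equal.\<close>
  have QQ'U: "Q *\<^sub>v (?Q' *\<^sub>v (U *\<^sub>v x)) = U *\<^sub>v x" if x: "x \<in> carrier_vec m" for x
  proof -
    have "U *\<^sub>v x \<in> range_mat Q" unfolding ran unfolding range_mat_eq using x U by auto
    then obtain z where "z \<in> carrier_vec m" "U *\<^sub>v x = Q *\<^sub>v z"
      unfolding range_mat_eq using Q by auto
    then show ?thesis using Q'Q by simp
  qed
  \<comment> \<open>The change of coordinates from \<open>U\<close> to \<open>Q\<close>, that is
    \<open>U = Q P\<close>.\<close>
  define P where "P = ?Q' * U"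
  have P: "P \<in> carrier_mat m m" unfolding P_def using Q' U by (rule mult_carrier_mat)
  have P_app: "P *\<^sub>v x = ?Q' *\<^sub>v (U *\<^sub>v x)" if "x \<in> carrier_vec m" for x
    unfolding P_def by (rule assoc_mult_mat_vec[OF Q' U that])
  have QP: "Q *\<^sub>v (P *\<^sub>v x) = U *\<^sub>v x" if "x \<in> carrier_vec m" for x
    using QQ'U[OF that] P_app[OF that] by simp
  have "injective_mat P" unfolding injective_mat_def
  proof (intro ballI impI)
    fix x assume "x \<in> carrier_vec (dim_col P)" and 0: "P *\<^sub>v x = 0\<^sub>v (dim_row P)"
    then have x: "x \<in> carrier_vec m" using P by simp
    have "U *\<^sub>v x = Q *\<^sub>v 0\<^sub>v m" using QP[OF x] 0 P by simp
    also have "\<dots> = 0\<^sub>v n" using Q by (intro eq_vecI) auto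
    finally show "x = 0\<^sub>v (dim_col P)" using inj x U P by (simp add: injective_mat_def)
  qed
  then obtain P' where P': "P' \<in> carrier_mat m m" "P * P' = 1\<^sub>m m" "P' * P = 1\<^sub>m m"
    using P by (rule injective_mat_inverse)
  have P'P: "P' *\<^sub>v (P *\<^sub>v x) = x" if "x \<in> carrier_vec m" for x
    using assoc_mult_mat_vec[OF P'(1) P that] P'(3) that by simp
  have Q'u: "?Q' *\<^sub>v u = 0\<^sub>v m"
    using adjoint_kernel_cong[OF U Q _ u orth] ran by simp
  let ?G = "?Q' * A * Q"
  have Q'A: "?Q' * A \<in> carrier_mat m n" using Q' A by (rule mult_carrier_mat)
  have G: "?G \<in> carrier_mat m m" using Q'A Q by (rule mult_carrier_mat)
  \<comment> \<open>The similarity of the two projected matrices: the adjoint of \<open>Q\<close>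
    annihilates \<open>u\<close>, so the rank-one term of the Krylov relation disappears.\<close>
  have GP: "?G *\<^sub>v (P *\<^sub>v x) = P *\<^sub>v (H *\<^sub>v x)" if x: "x \<in> carrier_vec m" for x
  proof -
    have Px: "P *\<^sub>v x \<in> carrier_vec m" using P x by (rule mult_mat_vec_carrier)
    have Ux: "U *\<^sub>v x \<in> carrier_vec n" using U x by (rule mult_mat_vec_carrier)
    have Hx: "H *\<^sub>v x \<in> carrier_vec m" using H x by (rule mult_mat_vec_carrier)
    have UHx: "U *\<^sub>v (H *\<^sub>v x) \<in> carrier_vec n" using U Hx by (rule mult_mat_vec_carrier)
    have uc: "outer_prod u c \<in> carrier_mat n m"
      using u c unfolding outer_prod_def by (intro carrier_matI) auto
    have "?G *\<^sub>v (P *\<^sub>v x) = ?Q' *\<^sub>v (A *\<^sub>v (U *\<^sub>v x))"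
      using assoc_mult_mat_vec[OF Q'A Q Px] assoc_mult_mat_vec[OF Q' A Ux] QP[OF x] by simp
    also have "A *\<^sub>v (U *\<^sub>v x) = (A * U) *\<^sub>v x" by (rule assoc_mult_mat_vec[OF A U x, symmetric])
    also have "\<dots> = U *\<^sub>v (H *\<^sub>v x) + (x \<bullet>c c) \<cdot>\<^sub>v u"
      unfolding AU add_mult_distrib_mat_vec[OF mult_carrier_mat[OF U H] uc x]
        outer_prod_mult_vec[OF u c x] assoc_mult_mat_vec[OF U H x] ..
    also have "?Q' *\<^sub>v \<dots> = ?Q' *\<^sub>v (U *\<^sub>v (H *\<^sub>v x)) + (x \<bullet>c c) \<cdot>\<^sub>v 0\<^sub>v m"
      using mult_add_distrib_mat_vec[OF Q' UHx, of "(x \<bullet>c c) \<cdot>\<^sub>v u"]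
        mult_mat_vec[OF Q' u, of "x \<bullet>c c"] Q'u u by simp
    also have "\<dots> = P *\<^sub>v (H *\<^sub>v x)"
      unfolding P_app[OF Hx] using Q' UHx by (intro eq_vecI) auto
    finally show ?thesis .
  qed
  define W where "W = P' * Vt"
  have W: "W \<in> carrier_mat m l" unfolding W_def using P'(1) Vt by (rule mult_carrier_mat)
  have PW: "P *\<^sub>v (W *\<^sub>v y) = Vt *\<^sub>v y" if y: "y \<in> carrier_vec l" for y
  proof -
    have "Vt *\<^sub>v y \<in> carrier_vec m" using Vt y by (rule mult_mat_vec_carrier)
    then show ?thesis
      unfolding W_def assoc_mult_mat_vec[OF P'(1) Vt y]
      using assoc_mult_mat_vec[OF P P'(1)] P'(2) by (metis one_mult_mat_vec)
  qed
  have HW: "H *\<^sub>v (W *\<^sub>v y) = W *\<^sub>v (St *\<^sub>v y)" if y: "y \<in> carrier_vec l" for y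
  proof -
    have Wy: "W *\<^sub>v y \<in> carrier_vec m" using W y by (rule mult_mat_vec_carrier)
    have Sy: "St *\<^sub>v y \<in> carrier_vec l" using St y by (rule mult_mat_vec_carrier)
    have "P *\<^sub>v (H *\<^sub>v (W *\<^sub>v y)) = ?G *\<^sub>v (Vt *\<^sub>v y)" using GP[OF Wy] PW[OF y] by simp
    also have "\<dots> = Vt *\<^sub>v (St *\<^sub>v y)"
      using assoc_mult_mat_vec[OF G Vt y] assoc_mult_mat_vec[OF Vt St y] GVt by simp
    also have "\<dots> = P *\<^sub>v (W *\<^sub>v (St *\<^sub>v y))" using PW[OF Sy] by simp
    finally show ?thesis
      using P'P[OF mult_mat_vec_carrier[OF H Wy]] P'P[OF mult_mat_vec_carrier[OF W Sy]] by metis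
  qed
  have V'a: "mat_adjoint V' \<in> carrier_mat (m - l) m" and Va: "mat_adjoint V \<in> carrier_mat l m"
    using mat_adjoint_carrier[of V] mat_adjoint_carrier[of V'] V V' by auto
  define Z where "Z = mat_adjoint V' * W"
  have Z: "Z \<in> carrier_mat (m - l) l" unfolding Z_def using V'a W by (rule mult_carrier_mat)
  \<comment> \<open>The adjoint of \<open>V'\<close> is applied to \<open>H W = W St\<close>, and
    its intertwining property replaces \<open>H\<close> by \<open>S'\<close>. Columns are compared
    through unit vectors.\<close>
  have "S' * Z = Z * St"
  proof (rule mat_col_eqI)
    fix j assume "j < dim_col (Z * St)"
    then have j: "j < l" using St by simp
    let ?e = "unit_vec l j :: complex vec"
    have e: "?e \<in> carrier_vec l" by simp
    have We: "W *\<^sub>v ?e \<in> carrier_vec m" using W e by (rule mult_mat_vec_carrier)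
    have Se: "St *\<^sub>v ?e \<in> carrier_vec l" using St e by (rule mult_mat_vec_carrier)
    have "(S' * Z) *\<^sub>v ?e = S' *\<^sub>v (mat_adjoint V' *\<^sub>v (W *\<^sub>v ?e))"
      using assoc_mult_mat_vec[OF S' Z e] assoc_mult_mat_vec[OF V'a W e] by (simp add: Z_def)
    also have "\<dots> = mat_adjoint V' *\<^sub>v (W *\<^sub>v (St *\<^sub>v ?e))"
      using inv(3)[OF We] HW[OF e] by simp
    also have "\<dots> = (Z * St) *\<^sub>v ?e"
      using assoc_mult_mat_vec[OF Z St e] assoc_mult_mat_vec[OF V'a W Se] by (simp add: Z_def)
    finally show "col (S' * Z) j = col (Z * St) j"
      using mult_mat_unit_vec[OF mult_carrier_mat[OF S' Z] j] mult_mat_unit_vec[OF mult_carrier_mat[OF Z St] j]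
      by simp
  qed (use S' Z St in auto)
  \<comment> \<open>Diagonal entries of the triangular \<open>St\<close> are its eigenvalues, hence
    eigenvalues of \<open>S\<close>, and the spectra of \<open>S\<close> and \<open>S'\<close> are
    disjoint.\<close>
  moreover have "\<not> eigenvalue S' (St $$ (j, j))" if "j < l" for j
  proof -
    have "eigenvalue S (St $$ (j, j))"
      using eigenvalue_upper_triangular_diag[OF St ut that]
      unfolding eigenvalue_iff_eigvals[OF S] eigenvalue_iff_eigvals[OF St] ev .
    then show ?thesis using disj by (auto simp: spectrum_def)
  qed
  ultimately have Z0: "Z = 0\<^sub>m (m - l) l" by (intro sylvester_upper_triangular[OF S' St Z ut])
  \<comment> \<open>As the \<open>V'\<close> component of \<open>W\<close> is zero,
    \<open>W = V N\<close>. The square matrix \<open>N\<close> is invertible because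
    \<open>Vt\<close> has independent columns, so both inclusions of ranges follow.\<close>
  define N where "N = mat_adjoint V * W"
  have N: "N \<in> carrier_mat l l" unfolding N_def using Va W by (rule mult_carrier_mat)
  have VN: "V *\<^sub>v (N *\<^sub>v y) = W *\<^sub>v y" if y: "y \<in> carrier_vec l" for y
  proof -
    have "mat_adjoint V' *\<^sub>v (W *\<^sub>v y) = Z *\<^sub>v y"
      using assoc_mult_mat_vec[OF V'a W y] by (simp add: Z_def)
    also have "\<dots> = 0\<^sub>v (m - l)" unfolding Z0 using y by (intro eq_vecI) auto
    finally show ?thesis
      using inv(4)[OF mult_mat_vec_carrier[OF W y]] assoc_mult_mat_vec[OF Va W y] by (simp add: N_def)
  qed
  have UVN: "U * V *\<^sub>v (N *\<^sub>v y) = Q * Vt *\<^sub>v y" if y: "y \<in> carrier_vec l" for y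
    using assoc_mult_mat_vec[OF U V mult_mat_vec_carrier[OF N y]] assoc_mult_mat_vec[OF Q Vt y]
      VN[OF y] QP[OF mult_mat_vec_carrier[OF W y]] PW[OF y] by simp
  have "injective_mat N" unfolding injective_mat_def
  proof (intro ballI impI)
    fix y assume "y \<in> carrier_vec (dim_col N)" and 0: "N *\<^sub>v y = 0\<^sub>v (dim_row N)"
    then have y: "y \<in> carrier_vec l" using N by simp
    have "W *\<^sub>v y = V *\<^sub>v 0\<^sub>v l" using VN[OF y] 0 N by simp
    also have "\<dots> = 0\<^sub>v m" using V by (intro eq_vecI) auto
    finally have "Vt *\<^sub>v y = P *\<^sub>v 0\<^sub>v m" using PW[OF y] by simp
    also have "\<dots> = 0\<^sub>v m" using P by (intro eq_vecI) auto
    finally show "y = 0\<^sub>v (dim_col N)"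
      using orthonormal_cols_injective[OF Vt_orth] y Vt N by (simp add: injective_mat_def)
  qed
  then obtain N' where N': "N' \<in> carrier_mat l l" "N * N' = 1\<^sub>m l" "N' * N = 1\<^sub>m l"
    using N by (rule injective_mat_inverse)
  have NN': "N *\<^sub>v (N' *\<^sub>v x) = x" if "x \<in> carrier_vec l" for x
    using assoc_mult_mat_vec[OF N N'(1) that] N'(2) that by simp
  show ?thesis
  proof
    show "range_mat (U * V) \<subseteq> range_mat (Q * Vt)"
    proof
      fix z assume "z \<in> range_mat (U * V)"
      then obtain x where x: "x \<in> carrier_vec l" "z = U * V *\<^sub>v x"
        unfolding range_mat_eq using V by auto
      then have "z = Q * Vt *\<^sub>v (N' *\<^sub>v x)"
        using UVN[OF mult_mat_vec_carrier[OF N'(1) x(1)]] NN'[OF x(1)] by simp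
      then show "z \<in> range_mat (Q * Vt)"
        unfolding range_mat_eq using mult_mat_vec_carrier[OF N'(1) x(1)] Vt by auto
    qed
    show "range_mat (Q * Vt) \<subseteq> range_mat (U * V)"
    proof
      fix z assume "z \<in> range_mat (Q * Vt)"
      then obtain y where y: "y \<in> carrier_vec l" "z = Q * Vt *\<^sub>v y"
        unfolding range_mat_eq using Vt by auto
      then show "z \<in> range_mat (U * V)"
        unfolding range_mat_eq using UVN[OF y(1), symmetric] mult_mat_vec_carrier[OF N y(1)] y(2) V by auto
    qed
  qed
qed

text \<open>Write \<open>?v\<close> for the part of \<open>p\<close> orthogonal to the range of
  \<open>M\<close>. Then \<open>q\<close> is an element of that range plus a multiple of
  \<open>?v\<close>. Since \<open>q\<close> is orthogonal to the range too, the first part vanishes,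
  and \<open>q\<close> being nonzero makes the multiple nonzero.\<close>

lemma orthogonal_complement_line_eq:
  assumes M: "M \<in> carrier_mat n k" and N: "N \<in> carrier_mat n j"
    and ran: "range_mat M = range_mat N"
    and p: "p \<in> carrier_vec n" and h: "h \<in> carrier_vec k" and Mp: "mat_adjoint M *\<^sub>v (p - M *\<^sub>v h) = 0\<^sub>v k"
    and x: "x \<in> carrier_vec k" and q: "q = M *\<^sub>v x + a \<cdot>\<^sub>v p"
    and Nq: "mat_adjoint N *\<^sub>v q = 0\<^sub>v j" and nz: "q \<noteq> 0\<^sub>v n"
  shows "cspan n {q} = cspan n {p - M *\<^sub>v h}"
proof -
  let ?v = "p - M *\<^sub>v h"
  have M': "mat_adjoint M \<in> carrier_mat k n" using mat_adjoint_carrier[of M] M by auto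
  have Mx: "M *\<^sub>v x \<in> carrier_vec n" using M x by (rule mult_mat_vec_carrier)
  have Mh: "M *\<^sub>v h \<in> carrier_vec n" using M h by (rule mult_mat_vec_carrier)
  have v: "?v \<in> carrier_vec n" using p Mh by auto
  \<comment> \<open>Replacing \<open>p\<close> by \<open>?v + M h\<close> moves the multiple of
    \<open>h\<close> into the coefficient vector of \<open>M\<close>.\<close>
  define y where "y = x + a \<cdot>\<^sub>v h"
  have y: "y \<in> carrier_vec k" using x h by (simp add: y_def)
  have My: "M *\<^sub>v y \<in> carrier_vec n" using M y by (rule mult_mat_vec_carrier)
  have "M *\<^sub>v y = M *\<^sub>v x + a \<cdot>\<^sub>v (M *\<^sub>v h)"
    unfolding y_def using mult_add_distrib_mat_vec[OF M x, of "a \<cdot>\<^sub>v h"] mult_mat_vec[OF M h] h by simp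
  then have q_eq: "q = M *\<^sub>v y + a \<cdot>\<^sub>v ?v"
    unfolding q using M Mx Mh p by (intro eq_vecI) (auto simp: algebra_simps)
  have qc: "q \<in> carrier_vec n" unfolding q using Mx p by simp
  have "mat_adjoint M *\<^sub>v q = 0\<^sub>v k"
    by (rule adjoint_kernel_cong[OF N M _ qc Nq]) (simp add: ran)
  moreover have "mat_adjoint M *\<^sub>v q = mat_adjoint M *\<^sub>v (M *\<^sub>v y) + a \<cdot>\<^sub>v 0\<^sub>v k"
    unfolding q_eq using mult_add_distrib_mat_vec[OF M' My, of "a \<cdot>\<^sub>v ?v"] mult_mat_vec[OF M' v] v Mp by simp
  moreover have "\<dots> = mat_adjoint M *\<^sub>v (M *\<^sub>v y)"
    using mult_mat_vec_carrier[OF M' My] M by (intro eq_vecI) auto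
  ultimately have "M *\<^sub>v y = 0\<^sub>v n"
    using mult_mat_vec_eq_0_if_adjoint[of y M] y M by simp
  then have qv: "q = a \<cdot>\<^sub>v ?v" using q_eq v by simp
  have a: "a \<noteq> 0"
  proof
    assume "a = 0"
    then have "q = 0\<^sub>v n" unfolding qv using v M by (intro eq_vecI) auto
    then show False using nz by simp
  qed
  have s: "{q} \<subseteq> carrier_vec n" "{?v} \<subseteq> carrier_vec n" using qc v by auto
  have "q \<in> cspan n {?v}" using cspan_superset[OF s(2)] cspan_smult[OF s(2)] qv by auto
  moreover have "?v = (1 / a) \<cdot>\<^sub>v q" unfolding qv using a by (simp add: smult_smult_assoc)
  then have "?v \<in> cspan n {q}" using cspan_superset[OF s(1)] cspan_smult[OF s(1)] by auto
  ultimately show ?thesis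
    using cspan_least[OF s(1), of "{?v}"] cspan_least[OF s(2), of "{q}"] by blast
qed

theorem lemma3p1:
  fixes A \<Omega> :: "complex mat" and n m l d :: nat and \<epsilon> :: real
    and U_old H_old V V' S Sx S' :: "complex mat" and u_old c_old :: "complex vec"
    and U_new H_new Q_new G_new :: "complex mat" and u_new c_new d_new :: "complex vec"
    and Q_old G_old Vt St :: "complex mat" and d_old :: "complex vec"
    and Qt Gt :: "complex mat" and gt :: real and qt ct :: "complex vec"
  assumes A: "A \<in> carrier_mat n n"
    and Omega: "\<Omega> \<in> carrier_mat d n"
    and l: "1 \<le> l" "l < m"
    and K: "krylov_decomp A n m U_old H_old u_old c_old"
      "mat_adjoint U_old *\<^sub>v u_old = 0\<^sub>v m"
      "full_col_rank U_old"
    and schur: "ordered_schur H_old m l V V' S Sx S'"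
    and disj: "spectrum S \<inter> spectrum S' = {}"
    and cycle: "rks_cycle A \<Omega> U_old u_old c_old V S = (U_new, H_new, u_new, c_new)"
    and assoc_new: "assoc_orthonormal A U_new c_new Q_new G_new d_new"
    and assoc_old: "assoc_orthonormal A U_old c_old Q_old G_old d_old"
    and partial: "partial_schur G_old m l Vt St"
    and same_eigvals: "eigvals S = eigvals St"
    and expand: "std_expand A Q_old u_old d_old Vt St = (Qt, Gt, gt, qt, ct)"
    and no_breakdown: "u_old \<noteq> 0\<^sub>v n"
      "0\<^sub>v n \<notin> set (rks_residuals A \<Omega> U_old u_old V)"
      "0\<^sub>v n \<notin> set (std_residuals A Q_old u_old Vt)"
    and eps: "0 < \<epsilon>" "\<epsilon> < 1"
    and embed: "subspace_embedding \<epsilon> \<Omega> (rks_space A \<Omega> U_old u_old V)"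
  shows "range_mat Qt = range_mat Q_new \<and> cspan n {qt} = cspan n {u_new}"
proof -
  \<comment> \<open>The starting lists already have \<open>l + 1\<close> vectors, so
    \<open>k\<close> steps give the first \<open>m\<close> basis vectors and step
    \<open>Suc k\<close> gives the vector after them.\<close>
  define k where "k = m - l - 1"
  have k: "m - l = Suc k" using l by (simp add: k_def)
  have m: "l + Suc k = m" using l by (simp add: k_def)
  have U: "U_old \<in> carrier_mat n m" and u: "u_old \<in> carrier_vec n"
    and H: "H_old \<in> carrier_mat m m" and c: "c_old \<in> carrier_vec m"
    and AU: "A * U_old = U_old * H_old + outer_prod u_old c_old"
    using K(1) unfolding krylov_decomp_def by auto
  have V: "V \<in> carrier_mat m l" and S: "S \<in> carrier_mat l l" using schur unfolding ordered_schur_def by auto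
  have Q: "Q_old \<in> carrier_mat n m" and Q_orth: "orthonormal_cols Q_old"
    and Q_ran: "range_mat Q_old = range_mat U_old" and G_old: "G_old = mat_adjoint Q_old * A * Q_old"
    using assoc_old U unfolding assoc_orthonormal_def by auto
  have Vt: "Vt \<in> carrier_mat m l" and Vt_orth: "orthonormal_cols Vt"
    using partial unfolding partial_schur_def by auto
  have U_inj: "injective_mat U_old" using K(3) by (rule full_col_rank_injective)
  note schur_inv = ordered_schur_invariance[OF schur H less_imp_le[OF l(2)]]
  have UV: "U_old * V \<in> carrier_mat n l" using U V by (rule mult_carrier_mat)
  have QVt: "Q_old * Vt \<in> carrier_mat n l" using Q Vt by (rule mult_carrier_mat)
  have ran0: "range_mat (U_old * V) = range_mat (Q_old * Vt)"
    using compressed_range_eq[OF A K(1,2) U_inj schur less_imp_le[OF l(2)] disj Q Q_orth Q_ran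
        partial[unfolded G_old] same_eigvals] .

  \<comment> \<open>The two starting bases and their common span\<close>
  have colsUV: "set (cols (U_old * V)) \<subseteq> carrier_vec n"
    using cols_dim[of "U_old * V"] unfolding carrier_matD(1)[OF UV] .
  have colsQV: "set (cols (Q_old * Vt)) \<subseteq> carrier_vec n"
    using cols_dim[of "Q_old * Vt"] unfolding carrier_matD(1)[OF QVt] .
  define us where "us = rks_start U_old u_old V"
  define vs where "vs = cols (Q_old * Vt) @ [std_start u_old]"
  have us: "set us \<subseteq> carrier_vec n" "us \<noteq> []" "length us = Suc l"
    using colsUV u carrier_matD(2)[OF V] by (simp_all add: us_def rks_start_def)
  have qc: "std_start u_old \<in> carrier_vec n" using u by (simp add: std_start_def)
  have vs: "set vs \<subseteq> carrier_vec n" "vs \<noteq> []" "length vs = Suc l"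
    using colsQV qc carrier_matD(2)[OF Vt] by (simp_all add: vs_def)

  have UHu: "mat_adjoint (U_old * V) *\<^sub>v u_old = 0\<^sub>v l"
  proof (rule adjoint_kernel_cong[OF U UV _ u K(2)])
    show "range_mat (U_old * V) \<subseteq> range_mat U_old"
    proof
      fix z assume "z \<in> range_mat (U_old * V)"
      then obtain x where x: "x \<in> carrier_vec l" "z = U_old * V *\<^sub>v x" unfolding range_mat_eq using V by auto
      then show "z \<in> range_mat U_old" unfolding range_mat_eq
        using assoc_mult_mat_vec[OF U V x(1)] mult_mat_vec_carrier[OF V x(1)] U by auto
    qed
  qed
  have QHu: "mat_adjoint (Q_old * Vt) *\<^sub>v u_old = 0\<^sub>v l"
    by (rule adjoint_kernel_cong[OF UV QVt _ u UHu]) (simp only: ran0 order_refl)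

  have u_start: "std_start u_old = (1 / complex_of_real (cvec_norm u_old)) \<cdot>\<^sub>v u_old"
    by (simp add: std_start_def)
  have norm_u: "cvec_norm u_old \<noteq> 0" using no_breakdown(1) u by (simp add: cvec_norm_eq_0_iff)
  \<comment> \<open>The vectors appended to the two compressed bases differ only by a nonzero
    factor.\<close>
  have u_eq: "u_old = complex_of_real (cvec_norm u_old) \<cdot>\<^sub>v std_start u_old"
    using norm_u by (simp add: std_start_def smult_smult_assoc)

  have span0: "cspan n (set us) = cspan n (set vs)"
  proof
    have cols_eq: "cspan n (set (cols (U_old * V))) = cspan n (set (cols (Q_old * Vt)))"
      using ran0 unfolding range_mat_cols[OF UV] range_mat_cols[OF QVt] .
    have sv: "cspan n (set (cols (Q_old * Vt))) \<subseteq> cspan n (set vs)" by (rule cspan_mono) (auto simp: vs_def)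
    have su: "cspan n (set (cols (U_old * V))) \<subseteq> cspan n (set us)"
      by (rule cspan_mono) (auto simp: us_def rks_start_def)
    have "u_old \<in> cspan n (set vs)"
      using cspan_superset[OF vs(1)] by (subst u_eq, intro cspan_smult[OF vs(1)]) (auto simp: vs_def)
    then show "cspan n (set us) \<subseteq> cspan n (set vs)"
      using cspan_superset[OF colsUV] cols_eq sv
      by (intro cspan_least[OF vs(1)]) (auto simp: us_def rks_start_def)
    have "std_start u_old \<in> cspan n (set us)"
      unfolding u_start using cspan_superset[OF us(1)] by (intro cspan_smult[OF us(1)]) (auto simp: us_def rks_start_def)
    then show "cspan n (set vs) \<subseteq> cspan n (set us)"
      using cspan_superset[OF colsQV] cols_eq su
      by (intro cspan_least[OF us(1)]) (auto simp: vs_def)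
  qed

  \<comment> \<open>The image of the compressed subspace\<close>
  have AUV: "A *\<^sub>v z \<in> cspan n (set us)" if z: "z \<in> range_mat (U_old * V)" for z
  proof -
    obtain x where x: "x \<in> carrier_vec l" "z = U_old * V *\<^sub>v x"
      using z unfolding range_mat_eq using V by auto
    have Vx: "V *\<^sub>v x \<in> carrier_vec m" using V x(1) by (rule mult_mat_vec_carrier)
    have Sx: "S *\<^sub>v x \<in> carrier_vec l" using S x(1) by (rule mult_mat_vec_carrier)
    have uc: "outer_prod u_old c_old \<in> carrier_mat n m"
      using u c unfolding outer_prod_def by (intro carrier_matI) auto
    have "A *\<^sub>v z = (A * U_old) *\<^sub>v (V *\<^sub>v x)"
      using assoc_mult_mat_vec[OF A U Vx] assoc_mult_mat_vec[OF U V x(1)] x(2) by simp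
    also have "\<dots> = U_old *\<^sub>v (H_old *\<^sub>v (V *\<^sub>v x)) + ((V *\<^sub>v x) \<bullet>c c_old) \<cdot>\<^sub>v u_old"
      unfolding AU add_mult_distrib_mat_vec[OF mult_carrier_mat[OF U H] uc Vx]
        outer_prod_mult_vec[OF u c Vx] assoc_mult_mat_vec[OF U H Vx] ..
    also have "\<dots> = U_old * V *\<^sub>v (S *\<^sub>v x) + ((V *\<^sub>v x) \<bullet>c c_old) \<cdot>\<^sub>v u_old"
      using schur_inv(2)[OF x(1)] assoc_mult_mat_vec[OF U V Sx] by simp
    finally have "A *\<^sub>v z = U_old * V *\<^sub>v (S *\<^sub>v x) + ((V *\<^sub>v x) \<bullet>c c_old) \<cdot>\<^sub>v u_old" .
    moreover have "U_old * V *\<^sub>v (S *\<^sub>v x) \<in> range_mat (U_old * V)"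
      unfolding range_mat_eq using Sx V by auto
    then have "U_old * V *\<^sub>v (S *\<^sub>v x) \<in> cspan n (set us)"
      unfolding range_mat_cols[OF UV] using cspan_mono[of "set (cols (U_old * V))" "set us" n]
      by (auto simp: us_def rks_start_def)
    moreover have "u_old \<in> cspan n (set us)"
      using cspan_superset[OF us(1)] by (auto simp: us_def rks_start_def)
    ultimately show ?thesis using cspan_add[OF us(1)] cspan_smult[OF us(1)] by auto
  qed
  have inv_us: "A *\<^sub>v z \<in> cspan n (set us)" if "z \<in> set (butlast us)" for z
    using that cspan_superset[OF colsUV] AUV unfolding range_mat_cols[OF UV]
    by (auto simp: us_def rks_start_def)
  \<comment> \<open>\<open>butlast vs\<close> consists of the columns of \<open>Q_old * Vt\<close>.
    Their range and the span of \<open>vs\<close> agree with those of the other process, so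
    \<open>AUV\<close> applies here too.\<close>
  have inv_vs: "A *\<^sub>v z \<in> cspan n (set vs)" if "z \<in> set (butlast vs)" for z
    using that cspan_superset[OF colsQV] AUV unfolding ran0 range_mat_cols[OF QVt] span0
    by (auto simp: vs_def)

  \<comment> \<open>The expanded bases and the kernel of the sketch\<close>
  define B where "B = arnoldi_basis (sketch_coeff \<Omega>) (sketch_norm \<Omega>) A us"
  define C where "C = arnoldi_basis gs_coeff cvec_norm A vs"
  define R where "R = arnoldi_residuals (sketch_coeff \<Omega>) (sketch_norm \<Omega>) A us (Suc k)"
  have Bc: "set (B j) \<subseteq> carrier_vec n" "length (B j) = Suc l + j" for j
    unfolding B_def using arnoldi_basis_carrier[OF A us(1)] us(3) by auto
  have Cc: "set (C j) \<subseteq> carrier_vec n" "length (C j) = Suc l + j" for j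
    unfolding C_def using arnoldi_basis_carrier[OF A vs(1)] vs(3) by auto

  have dims: "dim_col U_old = m" "dim_col V = l" "dim_col Q_old = m" "dim_col Vt = l" "dim_row A = n"
    using U V Q Vt A by auto
  have R0: "0\<^sub>v n \<notin> set R"
    using no_breakdown(2) by (simp add: rks_residuals_def dims k R_def us_def)
  have C0: "0\<^sub>v n \<notin> set (arnoldi_residuals gs_coeff cvec_norm A vs (Suc k))"
    using no_breakdown(3) by (simp add: std_residuals_def dims k vs_def)
  have W: "rks_space A \<Omega> U_old u_old V = cspan n (set (B (Suc k)) \<union> set R)"
    unfolding rks_space_def rks_residuals_def dims k B_def R_def us_def ..
  have Rc: "set R \<subseteq> carrier_vec n"
    using arnoldi_residual_carrier[OF A] by (auto simp: R_def arnoldi_residuals_def)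
  have ker: "w = 0\<^sub>v n" if w: "w \<in> cspan n (set (B (Suc k)) \<union> set R)" and 0: "\<Omega> *\<^sub>v w = 0\<^sub>v d" for w
  proof -
    have "w \<in> carrier_vec n" using cspan_carrier[of "set (B (Suc k)) \<union> set R" n] Bc Rc w by blast
    then have dim: "dim_vec w = n" by simp
    have "\<Omega> *\<^sub>v w = 0\<^sub>v (dim_row \<Omega>)" using 0 Omega by simp
    from subspace_embedding_kernel[OF embed[unfolded W] eps(2) w this] show ?thesis unfolding dim .
  qed

  \<comment> \<open>Independence of the sketched basis\<close>
  have us_inj: "injective_mat (mat_of_cols n us)"
    unfolding us_def rks_start_def
  proof (rule injective_mat_snoc[OF colsUV u])
    have "injective_mat (U_old * V)" unfolding injective_mat_def
    proof (intro ballI impI)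
      fix x assume "x \<in> carrier_vec (dim_col (U_old * V))" and 0: "U_old * V *\<^sub>v x = 0\<^sub>v (dim_row (U_old * V))"
      then have x: "x \<in> carrier_vec l" using V by simp
      have Vx: "V *\<^sub>v x \<in> carrier_vec m" using V x by (rule mult_mat_vec_carrier)
      have "U_old *\<^sub>v (V *\<^sub>v x) = 0\<^sub>v n" using assoc_mult_mat_vec[OF U V x] 0 U by simp
      then have "V *\<^sub>v x = 0\<^sub>v m" using U_inj U Vx by (simp add: injective_mat_def)
      then show "x = 0\<^sub>v (dim_col (U_old * V))" using schur_inv(1)[OF x] V by simp
    qed
    then show "injective_mat (mat_of_cols n (cols (U_old * V)))" using U mat_of_cols_cols[of "U_old * V"] by simp
    \<comment> \<open>The nonzero vector \<open>u_old\<close> is orthogonal to the compressed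
      subspace, so it cannot lie in it.\<close>
    show "u_old \<notin> cspan n (set (cols (U_old * V)))"
    proof
      assume "u_old \<in> cspan n (set (cols (U_old * V)))"
      then have "u_old \<in> range_mat (U_old * V)" unfolding range_mat_cols[OF UV] .
      then obtain x where "x \<in> carrier_vec l" "u_old = U_old * V *\<^sub>v x" unfolding range_mat_eq using V by auto
      then have "u_old = 0\<^sub>v n"
        using mult_mat_vec_eq_0_if_adjoint[of x "U_old * V", unfolded carrier_matD[OF UV]] UHu by simp
      then show False using no_breakdown(1) by simp
    qed
  qed
  note sketch = sketch_arnoldi[OF A Omega us(1,2) us_inj ker[unfolded B_def R_def] R0[unfolded R_def], folded B_def]

  \<comment> \<open>Orthonormality of the Gram--Schmidt basis\<close>
  have vs_orth: "orthonormal_cols (mat_of_cols n vs)"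
    unfolding vs_def
  proof (rule orthonormal_cols_snoc[OF colsQV qc])
    have Qa: "mat_adjoint Q_old \<in> carrier_mat m n" and Va: "mat_adjoint Vt \<in> carrier_mat l m"
      using mat_adjoint_carrier[of Q_old] mat_adjoint_carrier[of Vt] Q Vt by auto
    have "mat_adjoint (Q_old * Vt) * (Q_old * Vt) = (mat_adjoint Vt * mat_adjoint Q_old) * (Q_old * Vt)"
      using Q Vt by (subst mat_adjoint_mult) auto
    also have "\<dots> = mat_adjoint Vt * ((mat_adjoint Q_old * Q_old) * Vt)"
      using assoc_mult_mat[OF Va Qa QVt] assoc_mult_mat[OF Qa Q Vt] by simp
    also have "\<dots> = 1\<^sub>m l" using Q_orth Vt_orth Q Vt by (simp add: orthonormal_cols_def)
    finally have "orthonormal_cols (Q_old * Vt)" using Vt by (simp add: orthonormal_cols_def)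
    then show "orthonormal_cols (mat_of_cols n (cols (Q_old * Vt)))"
      using Q mat_of_cols_cols[of "Q_old * Vt"] by simp
    have QVa: "mat_adjoint (Q_old * Vt) \<in> carrier_mat l n" 
      using mat_adjoint_carrier[of "Q_old * Vt"] unfolding carrier_matD[OF QVt] .
    have "mat_adjoint (Q_old * Vt) *\<^sub>v std_start u_old = 0\<^sub>v l"
      unfolding u_start mult_mat_vec[OF QVa u] QHu by (simp add: vec_eq_iff)
    then show "mat_adjoint (mat_of_cols n (cols (Q_old * Vt))) *\<^sub>v std_start u_old = 0\<^sub>v (length (cols (Q_old * Vt)))"
      using Q Vt mat_of_cols_cols[of "Q_old * Vt"] by simp
    show "std_start u_old \<bullet>c std_start u_old = 1"
      unfolding std_start_def using no_breakdown(1) u by (intro cscalar_prod_normalized) auto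
  qed
  have C_orth: "orthonormal_cols (mat_of_cols n (C j))" if "j \<le> Suc k" for j
    unfolding C_def by (rule gs_arnoldi_orthonormal[OF A vs(1,2) vs_orth C0 that])
  have C_res0: "arnoldi_residual gs_coeff A (C j) \<noteq> 0\<^sub>v n" if "j < Suc k" for j
  proof -
    have "arnoldi_residual gs_coeff A (C j) \<in> set (arnoldi_residuals gs_coeff cvec_norm A vs (Suc k))"
      unfolding set_arnoldi_residuals C_def using that by (intro imageI) simp
    then show ?thesis using C0 by metis
  qed
  have C_norm: "cvec_norm (arnoldi_residual gs_coeff A (C j)) \<noteq> 0" if "j < Suc k" for j
    using C_res0[OF that] arnoldi_residual_carrier[OF A, of gs_coeff "C j"] by (simp add: cvec_norm_eq_0_iff)

  \<comment> \<open>Equality of the spans at every step\<close>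
  have B_span: "cspan n (set (B j)) = (krylov_step A ^^ j) (cspan n (set us))" if "j \<le> Suc k" for j
    unfolding B_def using that sketch(2,3)
    by (intro cspan_arnoldi_basis[OF A us(1,2) inv_us]) (auto simp: B_def)
  have C_span: "cspan n (set (C j)) = (krylov_step A ^^ j) (cspan n (set vs))" if "j \<le> Suc k" for j
    unfolding C_def
  proof (rule cspan_arnoldi_basis[OF A vs(1,2) inv_vs])
    fix i assume i: "i < j"
    show "arnoldi_coeff gs_coeff A (arnoldi_basis gs_coeff cvec_norm A vs i) \<in> carrier_vec (length vs + i)"
      by (rule carrier_vecI) (simp add: arnoldi_coeff_def gs_coeff_def)
    show "cvec_norm (arnoldi_residual gs_coeff A (arnoldi_basis gs_coeff cvec_norm A vs i)) \<noteq> 0"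
      using C_norm[of i] i that by (simp add: C_def)
  qed
  have span_eq: "cspan n (set (C j)) = cspan n (set (B j))" if "j \<le> Suc k" for j
    using B_span[OF that] C_span[OF that] span0 by simp

  \<comment> \<open>The first \<open>m\<close> basis vectors and the last one\<close>
  define M where "M = mat_of_cols n (B k)"
  define N where "N = mat_of_cols n (C k)"
  define p where "p = last (B (Suc k))"
  define q where "q = last (C (Suc k))"
  have M: "M \<in> carrier_mat n m" and N: "N \<in> carrier_mat n m"
    using m Bc(2) Cc(2) by (auto simp: M_def N_def)
  have BSuc: "B (Suc k) = B k @ [p]" and CSuc: "C (Suc k) = C k @ [q]"
    by (simp_all add: B_def C_def p_def q_def Let_def)
  have pc: "p \<in> carrier_vec n" and qc: "q \<in> carrier_vec n"
    using Bc(1)[of "Suc k"] Cc(1)[of "Suc k"] unfolding BSuc CSuc by auto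
  have take: "take m (B (Suc k)) = B k" "take m (C (Suc k)) = C k"
    unfolding BSuc CSuc using Bc(2)[of k] Cc(2)[of k] m by auto
  have U_new: "U_new = M" and u_new: "u_new = p - M *\<^sub>v (pinv M *\<^sub>v p)"
    using cycle U V
    by (auto simp: rks_cycle_def arnoldi_expand_def Let_def dims k take M_def p_def
        simp flip: rks_start_def us_def B_def)
  have Qt: "Qt = N" and qt: "qt = q"
    using expand Q Vt
    by (auto simp: std_expand_def arnoldi_expand_def Let_def dims k take N_def q_def
        simp flip: vs_def C_def)

  have "range_mat N = cspan n (set (C k))"
    unfolding N_def cspan_eq_range_mat[OF Cc(1)] ..
  moreover have "range_mat M = cspan n (set (B k))"
    unfolding M_def cspan_eq_range_mat[OF Bc(1)] ..
  ultimately have ranMN: "range_mat M = range_mat N" using span_eq[of k] by simp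
  have "range_mat Q_new = range_mat U_new" using assoc_new by (simp add: assoc_orthonormal_def)
  then have range_eq: "range_mat Qt = range_mat Q_new" unfolding Qt U_new using ranMN by simp

  \<comment> \<open>The line orthogonal to the common subspace\<close>
  have M_inj: "injective_mat M" unfolding M_def by (intro sketch(1) le_SucI order_refl)
  let ?h = "pinv M *\<^sub>v p"
  have "pinv M \<in> carrier_mat m n" using pinv_carrier[OF M_inj] M by simp
  then have h: "?h \<in> carrier_vec m" using pc by (rule mult_mat_vec_carrier)
  have Mp: "mat_adjoint M *\<^sub>v (p - M *\<^sub>v ?h) = 0\<^sub>v m"
    using adjoint_pinv_residual[OF M_inj] pc M by simp
  have "q \<in> cspan n (set (C (Suc k)))" using cspan_superset[OF Cc(1), of "Suc k"] by (simp add: CSuc)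
  then have "q \<in> cspan n (set (B (Suc k)))" using span_eq[of "Suc k"] by simp
  then obtain z where z: "z \<in> carrier_vec (length (B (Suc k)))" "q = mat_of_cols n (B (Suc k)) *\<^sub>v z"
    using cspan_elem[OF Bc(1)] by blast
  \<comment> \<open>Membership of \<open>q\<close> in the larger common span is split by the last
    column: \<open>z $ m\<close> is the coefficient of \<open>p\<close>, and the first
    \<open>m\<close> entries belong to \<open>M\<close>.\<close>
  have q_eq: "q = M *\<^sub>v vec m (\<lambda>i. z $ i) + (z $ m) \<cdot>\<^sub>v p"
    using mat_of_cols_snoc_mult[OF Bc(1)[of k] pc, of z] z Bc(2)[of k] m
    by (simp add: BSuc M_def)
  let ?r = "arnoldi_residual gs_coeff A (C k)"
  have q_def': "q = (1 / complex_of_real (cvec_norm ?r)) \<cdot>\<^sub>v ?r"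
    by (simp add: q_def C_def Let_def)
  have rc: "?r \<in> carrier_vec n" by (rule arnoldi_residual_carrier[OF A])
  have Ck: "C k \<noteq> []" using Cc(2)[of k] by auto
  have Nr: "mat_adjoint N *\<^sub>v ?r = 0\<^sub>v m"
    unfolding N_def using gs_step[OF A Cc(1) Ck C_orth] Cc(2)[of k] m by simp
  have N': "mat_adjoint N \<in> carrier_mat m n" using mat_adjoint_carrier[of N] N by auto
  have Nq: "mat_adjoint N *\<^sub>v q = 0\<^sub>v m"
    unfolding q_def' mult_mat_vec[OF N' rc] Nr by (simp add: vec_eq_iff)
  have "q \<bullet>c q = 1"
    unfolding q_def' using C_res0[of k] rc by (intro cscalar_prod_normalized) auto
  \<comment> \<open>Normalization enters here: a unit vector is nonzero, so the coefficient of the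
    corrected residual in \<open>q\<close> cannot vanish.\<close>
  then have q0: "q \<noteq> 0\<^sub>v n" using qc by (metis conjugate_square_eq_0_vec zero_neq_one)
  have "cspan n {q} = cspan n {p - M *\<^sub>v ?h}"
    by (rule orthogonal_complement_line_eq[OF M N ranMN pc h Mp _ q_eq Nq q0]) simp
  then show ?thesis using range_eq by (simp add: qt u_new)
qed

end
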